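(* Let $1\le p<\infty$. Assume that $\mu$ is globally doubling and that $X$ supports a global $p$-Poincaré inequality. Let $a>0$. Then there is a constant $C\ge1$, independent of $r$ and $R$, such that the following holds. Let $0<\tfrac12R\le r<R$ and $\delta=R-r$, and assume that for every $x\in B_R\setminus B_r$ there exist points $x',x''\in X$ such that $$B(x',a\delta)\subset B(x,2\delta)\cap B_r\quad\text{and}\quad B(x'',a\delta)\subset B(x,2\delta)\setminus B_R.$$ Then $$\frac1C\,\frac{\mu(B_R\setminus B_r)}{(R-r)^p}\le\operatorname{cap}_p(B_r,B_R)\le C\,\frac{\mu(B_R\setminus B_r)}{(R-r)^p}.$$
   Context: $X=(X,d,\mu)$ is a metric space equipped with a metric $d$ and a positive complete Borel measure $\mu$ such that $0<\mu(B)<\infty$ for all balls $B\subset X$. Write $B(x,r)=\{y\in X: d(y,x)<r\}$; $x_0\in X$ is a fixed but arbitrary point and $B_r=B(x_0,r)$. For a ball $B=B(x,r)$ and $\lambda>0$, $\lambda B=B(x,\lambda r)$. Doubling: $\mu$ is globally doubling if there is $C>0$ such that $\mu(B(x,2r))\le C\mu(B(x,r))$ for all $x\in X$ and $r>0$. Upper gradients and Newtonian space: curves are nonconstant, compact and rectifiable, parameterized by arc length $ds$. A Borel function $g:X\to[0,\infty]$ is an upper gradient of $f:X\to[-\infty,\infty]$ if for all curves $\gamma:[0,l_\gamma]\to X$, $|f(\gamma(0))-f(\gamma(l_\gamma))|\le\int_\gamma g\,ds$, where the left-hand side is considered to be $\infty$ whenever at least one of the terms therein is infinite. A measurable $g:X\to[0,\infty]$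 is a $p$-weak upper gradient of $f$ if this inequality holds for $p$-almost every curve, i.e. except for a family $\Gamma$ of curves for which there is $0\le\rho\in L^p(X)$ with $\int_\gamma\rho\,ds=\infty$ for all $\gamma\in\Gamma$. If $f$ has an upper gradient in $L^p(X)$, then $g_f$ denotes its (a.e. unique) minimal $p$-weak upper gradient in $L^p(X)$, i.e. $g_f\le g$ a.e. for every $p$-weak upper gradient $g\in L^p(X)$ of $f$. $N^{1,p}(X)$ is the space of measurable functions $f:X\to[-\infty,\infty]$ (defined everywhere) with $\|f\|_{N^{1,p}(X)}=\bigl(\int_X|f|^p\,d\mu+\inf_g\int_X g^p\,d\mu\bigr)^{1/p}<\infty$, the infimum being over all upper gradients $g$ of $f$. Poincaré inequality: $X$ supports a global $p$-Poincaré inequality if there are constants $C>0$ and $\lambda\ge1$ such that for all balls $B=B(x,r)$, $x\in X$, $r>0$, all integrable functions $f$ on $X$ and all upper gradients $g$ of $f$, $\frac1{\mu(B)}\int_B|f-f_B|\,d\mu\le Cr\bigl(\frac1{\mu(\lambda B)}\int_{\lambda B}g^p\,d\mu\bigr)^{1/p}$, where $f_B=\frac1{\mu(B)}\int_Bf\,d\mu$. Variational capacity: for $\Omega\subset X$ open and $E\subset\Omega$, $\operatorname{cap}_p(E,\Omega)=\inf_u\int_\Omega g_u^p\,d\mu$, the infimum being over all $u\in N^{1,p}(X)$ with $\chi_E\le u\le1$ in $\Omega$ and $u=0$ on $X\setminus\Omega$. *)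

theory Defs
  imports "HOL-Analysis.Analysis"
begin

text \<open>The metric space \<open>X\<close> is a whole type of class \<^class>\<open>metric_space\<close>.\<close>

text \<open>
  A complete Borel measure is the completion of a measure on the Borel
  \<open>\<sigma>\<close>-algebra; measurable below always means measurable for this completed \<open>\<sigma>\<close>-algebra.
\<close>

definition metric_measure_space :: "'a::metric_space measure \<Rightarrow> bool" where
  "metric_measure_space M \<longleftrightarrow>
     (\<exists>N. sets N = sets borel \<and> M = completion N) \<and>
     (\<forall>x r. 0 < r \<longrightarrow> 0 < emeasure M (ball x r) \<and> emeasure M (ball x r) < \<infinity>)"

definition globally_doubling :: "'a::metric_space measure \<Rightarrow> bool" where
  "globally_doubling M \<longleftrightarrow>
     (\<exists>C>0. \<forall>x r. 0 < r \<longrightarrow>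
        emeasure M (ball x (2 * r)) \<le> ennreal C * emeasure M (ball x r))"

text \<open>Real powers on \<open>[0,\<infinity>]\<close>, only used for positive exponents.\<close>

definition epowr :: "ennreal \<Rightarrow> real \<Rightarrow> ennreal" where
  "epowr x q = (if x = \<infinity> then \<infinity> else ennreal (enn2real x powr q))"

definition in_Lp :: "'a measure \<Rightarrow> real \<Rightarrow> ('a \<Rightarrow> ennreal) \<Rightarrow> bool" where
  "in_Lp M p g \<longleftrightarrow> g \<in> borel_measurable M \<and> (\<integral>\<^sup>+x. epowr (g x) p \<partial>M) < \<infinity>"

definition curve_length :: "(real \<Rightarrow> 'a::metric_space) \<Rightarrow> real \<Rightarrow> real \<Rightarrow> ennreal" where
  "curve_length \<gamma> s t =
     (SUP ts \<in> {ts. sorted ts \<and> set ts \<subseteq> {s..t}}.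
        \<Sum>i<length ts - 1. ennreal (dist (\<gamma> (ts ! i)) (\<gamma> (ts ! Suc i))))"

text \<open>
  A nonconstant compact rectifiable curve, parameterized by arc length on \<open>[0,l]\<close>.
  Continuity and nonconstancy follow from the length condition and \<open>l > 0\<close>;
  the values of \<open>\<gamma>\<close> outside \<open>[0,l]\<close> are irrelevant.
\<close>

definition is_curve :: "(real \<Rightarrow> 'a::metric_space) \<Rightarrow> real \<Rightarrow> bool" where
  "is_curve \<gamma> l \<longleftrightarrow>
     0 < l \<and> (\<forall>s t. 0 \<le> s \<and> s \<le> t \<and> t \<le> l \<longrightarrow> curve_length \<gamma> s t = ennreal (t - s))"

text \<open>
  For \<open>g\<close> Borel the integrand is Borel on \<open>[0,l]\<close>. For \<open>g\<close> measurable with respect to the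
  completion only, it is Lebesgue measurable along \<open>p\<close>-almost every curve; on the
  remaining curves \<^const>\<open>nn_integral\<close> is a lower integral.
\<close>

definition curve_integral :: "('a \<Rightarrow> ennreal) \<Rightarrow> (real \<Rightarrow> 'a::metric_space) \<Rightarrow> real \<Rightarrow> ennreal" where
  "curve_integral g \<gamma> l = (\<integral>\<^sup>+t\<in>{0..l}. g (\<gamma> t) \<partial>lebesgue)"

definition endpoint_diff :: "ereal \<Rightarrow> ereal \<Rightarrow> ennreal" where
  "endpoint_diff a b =
     (if \<bar>a\<bar> = \<infinity> \<or> \<bar>b\<bar> = \<infinity> then \<infinity> else e2ennreal \<bar>a - b\<bar>)"

definition ug_inequality ::
  "('a::metric_space \<Rightarrow> ereal) \<Rightarrow> ('a \<Rightarrow> ennreal) \<Rightarrow> (real \<Rightarrow> 'a) \<Rightarrow> real \<Rightarrow> bool" where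
  "ug_inequality f g \<gamma> l \<longleftrightarrow> endpoint_diff (f (\<gamma> 0)) (f (\<gamma> l)) \<le> curve_integral g \<gamma> l"

definition upper_gradient :: "('a::metric_space \<Rightarrow> ereal) \<Rightarrow> ('a \<Rightarrow> ennreal) \<Rightarrow> bool" where
  "upper_gradient f g \<longleftrightarrow>
     g \<in> borel_measurable borel \<and> (\<forall>\<gamma> l. is_curve \<gamma> l \<longrightarrow> ug_inequality f g \<gamma> l)"

definition exceptional_family ::
  "'a::metric_space measure \<Rightarrow> real \<Rightarrow> ((real \<Rightarrow> 'a) \<times> real) set \<Rightarrow> bool" where
  "exceptional_family M p \<Gamma> \<longleftrightarrow>
     (\<exists>\<rho>. in_Lp M p \<rho> \<and> (\<forall>(\<gamma>, l)\<in>\<Gamma>. curve_integral \<rho> \<gamma> l = \<infinity>))"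

definition weak_upper_gradient ::
  "'a::metric_space measure \<Rightarrow> real \<Rightarrow> ('a \<Rightarrow> ereal) \<Rightarrow> ('a \<Rightarrow> ennreal) \<Rightarrow> bool" where
  "weak_upper_gradient M p f g \<longleftrightarrow>
     g \<in> borel_measurable M \<and>
     exceptional_family M p {(\<gamma>, l). is_curve \<gamma> l \<and> \<not> ug_inequality f g \<gamma> l}"

definition is_minimal_weak_ug ::
  "'a::metric_space measure \<Rightarrow> real \<Rightarrow> ('a \<Rightarrow> ereal) \<Rightarrow> ('a \<Rightarrow> ennreal) \<Rightarrow> bool" where
  "is_minimal_weak_ug M p f g \<longleftrightarrow>
     weak_upper_gradient M p f g \<and> in_Lp M p g \<and>
     (\<forall>h. weak_upper_gradient M p f h \<and> in_Lp M p h \<longrightarrow> (AE x in M. g x \<le> h x))"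

text \<open>
  The minimal \<open>p\<close>-weak upper gradient \<open>g\<^sub>f\<close>, an arbitrary representative of its a.e. class;
  meaningful when \<open>f\<close> has an upper gradient in \<open>L\<^sup>p\<close>.
\<close>

definition minimal_weak_ug ::
  "'a::metric_space measure \<Rightarrow> real \<Rightarrow> ('a \<Rightarrow> ereal) \<Rightarrow> 'a \<Rightarrow> ennreal" where
  "minimal_weak_ug M p f = (SOME g. is_minimal_weak_ug M p f g)"

definition newtonian_norm :: "'a::metric_space measure \<Rightarrow> real \<Rightarrow> ('a \<Rightarrow> ereal) \<Rightarrow> ennreal" where
  "newtonian_norm M p f =
     epowr ((\<integral>\<^sup>+x. epowr (e2ennreal \<bar>f x\<bar>) p \<partial>M)
            + (INF g\<in>{g. upper_gradient f g}. \<integral>\<^sup>+x. epowr (g x) p \<partial>M)) (1 / p)"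

definition newtonian_space :: "'a::metric_space measure \<Rightarrow> real \<Rightarrow> ('a \<Rightarrow> ereal) set" where
  "newtonian_space M p = {f \<in> borel_measurable M. newtonian_norm M p f < \<infinity>}"

text \<open>For integrable \<open>f\<close>, the set where \<^const>\<open>real_of_ereal\<close> changes a value is null.\<close>

definition ball_average :: "'a::metric_space measure \<Rightarrow> ('a \<Rightarrow> ereal) \<Rightarrow> 'a \<Rightarrow> real \<Rightarrow> real" where
  "ball_average M f x r =
     (LINT y:ball x r|M. real_of_ereal (f y)) / measure M (ball x r)"

definition poincare_inequality :: "'a::metric_space measure \<Rightarrow> real \<Rightarrow> bool" where
  "poincare_inequality M p \<longleftrightarrow>
     (\<exists>C>0. \<exists>\<Lambda>\<ge>1. \<forall>x r f g.
        0 < r \<and> f \<in> borel_measurable M \<and> (\<integral>\<^sup>+y. e2ennreal \<bar>f y\<bar> \<partial>M) < \<infinity> \<and>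
        upper_gradient f g \<longrightarrow>
        (\<integral>\<^sup>+y\<in>ball x r. e2ennreal \<bar>f y - ereal (ball_average M f x r)\<bar> \<partial>M)
            / emeasure M (ball x r)
          \<le> ennreal (C * r) *
             epowr ((\<integral>\<^sup>+y\<in>ball x (\<Lambda> * r). epowr (g y) p \<partial>M)
                      / emeasure M (ball x (\<Lambda> * r))) (1 / p))"

text \<open>Used for \<open>\<Omega>\<close> open and \<open>E \<subseteq> \<Omega>\<close>; the infimum over the empty set is \<open>\<infinity>\<close>.\<close>

definition var_cap :: "'a::metric_space measure \<Rightarrow> real \<Rightarrow> 'a set \<Rightarrow> 'a set \<Rightarrow> ennreal" where
  "var_cap M p E \<Omega> =
     (INF u\<in>{u \<in> newtonian_space M p.
               (\<forall>x\<in>\<Omega>. indicator E x \<le> u x \<and> u x \<le> 1) \<and> (\<forall>x. x \<notin> \<Omega> \<longrightarrow> u x = 0)}.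
        \<integral>\<^sup>+x\<in>\<Omega>. epowr (minimal_weak_ug M p u x) p \<partial>M)"

end

theory Submission
  imports Defs
begin

text \<open>
  Upper bound: the cutoff that is linear in the distance to \<open>x0\<close> across the annulus has the
  upper gradient \<open>1 / (R - r)\<close> on the annulus and \<open>0\<close> elsewhere, since a curve between the two
  boundary spheres spends at least the length \<open>R - r\<close> in the annulus.

  Lower bound: an admissible \<open>u\<close> is \<open>1\<close> on \<open>B(x', a\<delta>)\<close> and \<open>0\<close> on \<open>B(x'', a\<delta>)\<close>, which by
  doubling are substantial parts of \<open>B(x, 2\<delta>)\<close>, so its mean oscillation there is bounded below
  and the Poincare inequality gives \<open>\<mu>(B(x, 2\<delta>)) \<le> C \<delta>\<^sup>p \<integral> g\<^sup>p\<close> over the enlarged ball. Summing over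
  a maximal \<open>2\<delta>\<close>-separated set of centres in the annulus, whose enlarged balls have bounded
  overlap, bounds the measure of the annulus. The integrals only see \<open>g\<close> inside \<open>B\<^sub>R\<close>,
  because \<open>u\<close> vanishes outside.
\<close>

section \<open>Extended powers, curves and curve integrals\<close>

text \<open>The capacity is built from minimal \<open>p\<close>-weak upper gradients, whereas the
  Poincare inequality speaks of genuine upper gradients. As \<open>minimal_weak_ug\<close> is a
  \<open>SOME\<close> term, nothing is known about it until a minimal element has been constructed;
  afterwards it is traded for a genuine upper gradient whose energy in the ball of radius
  \<open>R\<close> is larger by at most \<open>e\<close>, with \<open>e\<close> arbitrary. Curves
  can run inside null sets, so changes almost everywhere are not harmless, and weak upper gradients
  are handled through Borel functions that dominate them everywhere.

  The constant of the lower bound is \<open>(D ^ k * (C * 2)) powr p * D ^ j\<close>: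
  \<open>D ^ k\<close> compares a ball of radius 2\<delta> with one of radius a\<delta>, and
  \<open>D ^ j\<close> bounds the overlap of the enlarged balls. The number of centres depends on
  \<open>R / \<delta>\<close>, but only its finiteness matters.\<close>

lemma epowr_0 [simp]: "epowr 0 p = 0"
  by (simp add: epowr_def)

lemma epowr_top [simp]: "epowr top p = top"
  by (simp add: epowr_def)

lemma epowr_ennreal: "0 \<le> x \<Longrightarrow> epowr (ennreal x) p = ennreal (x powr p)"
  by (simp add: epowr_def)

lemma epowr_mono:
  assumes "0 < p" "x \<le> y"
  shows "epowr x p \<le> epowr y p"
proof (cases y)
  case (real b)
  with assms obtain a where "x = ennreal a" "0 \<le> a" "a \<le> b"
    by (cases x) (auto simp: top_unique)
  with real assms show ?thesis
    by (simp add: epowr_ennreal ennreal_leI powr_mono2)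
qed simp

lemma epowr_eq_iff:
  assumes "0 < p"
  shows "epowr x p = epowr y p \<longleftrightarrow> x = y"
proof -
  have "a = b" if "a powr p = b powr p" "0 \<le> a" "0 \<le> b" for a b :: real
    using that assms powr_inj[of "p"] by (metis powr_less_mono2 linorder_neqE_linordered_idom order_less_irrefl)
  then show ?thesis
    by (cases x; cases y) (auto simp: epowr_def)
qed

lemma epowr_eq_top_iff [simp]: "epowr x p = top \<longleftrightarrow> x = top"
  by (simp add: epowr_def)

lemma epowr_max_le: "epowr (max x y) p \<le> epowr x p + epowr y p"
  by (auto simp: max_def)

lemma epowr_cmult:
  assumes "0 < c"
  shows "epowr (ennreal c * x) p = ennreal (c powr p) * epowr x p"
proof (cases x)
  case (real r)
  then show ?thesis
    using assms by (simp add: epowr_ennreal ennreal_mult[symmetric] powr_mult)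
next
  case top
  then show ?thesis
    using assms by (simp add: ennreal_mult_top)
qed

lemma borel_measurable_epowr [measurable]:
  assumes [measurable]: "f \<in> borel_measurable M"
  shows "(\<lambda>x. epowr (f x) p) \<in> borel_measurable M"
  unfolding epowr_def by measurable

lemma endpoint_diff_real: "endpoint_diff (ereal a) (ereal b) = ennreal \<bar>a - b\<bar>"
  by (simp add: endpoint_diff_def)

lemma endpoint_diff_triangle: "endpoint_diff a c \<le> endpoint_diff a b + endpoint_diff b c"
proof -
  consider "\<bar>a\<bar> = \<infinity> \<or> \<bar>b\<bar> = \<infinity> \<or> \<bar>c\<bar> = \<infinity>" | x y z where "a = ereal x" "b = ereal y" "c = ereal z"
    by (cases a; cases b; cases c) auto
  then show ?thesis
  proof cases
    case 1
    then show ?thesis by (auto simp: endpoint_diff_def)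
  next
    case 2
    then show ?thesis
      by (simp add: endpoint_diff_real flip: ennreal_plus)
  qed
qed

lemma is_curve_dist_le:
  assumes "is_curve \<gamma> l" "0 \<le> s" "s \<le> t" "t \<le> l"
  shows "dist (\<gamma> s) (\<gamma> t) \<le> t - s"
proof -
  have "ennreal (dist (\<gamma> s) (\<gamma> t)) \<le> curve_length \<gamma> s t"
    unfolding curve_length_def
    by (rule SUP_upper2[of "[s, t]"]) (use assms in auto)
  also have "\<dots> = ennreal (t - s)"
    using assms by (auto simp: is_curve_def)
  finally show ?thesis
    using assms by simp
qed

lemma is_curve_continuous_on:
  assumes "is_curve \<gamma> l"
  shows "continuous_on {0..l} \<gamma>"
proof (rule continuous_onI)
  fix t e :: real assume "t \<in> {0..l}" "0 < e"
  have "dist (\<gamma> s) (\<gamma> t) \<le> dist s t" if "s \<in> {0..l}" for s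
    using is_curve_dist_le[OF assms, of s t] is_curve_dist_le[OF assms, of t s] that \<open>t \<in> {0..l}\<close>
    by (cases "s \<le> t") (auto simp: dist_real_def dist_commute)
  with \<open>0 < e\<close> show "\<exists>d>0. \<forall>s\<in>{0..l}. dist s t < d \<longrightarrow> dist (\<gamma> s) (\<gamma> t) \<le> e"
    by (intro exI[of _ e]) force
qed

lemma curve_length_shift: "curve_length (\<lambda>\<tau>. \<gamma> (c + \<tau>)) s t = curve_length \<gamma> (c + s) (c + t)"
proof -
  let ?A = "\<lambda>s t. {ts. sorted ts \<and> set ts \<subseteq> {s..t::real}}"
  \<comment> \<open>The shift \<open>d\<close> is kept free: \<open>d = c\<close> gives one
    inclusion of \<open>2\<close>, and \<open>d = - c\<close> gives preimages for the other.\<close>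
  have 1: "map (\<lambda>\<tau>. d + \<tau>) ts \<in> ?A (d + s) (d + t)" if "ts \<in> ?A s t" for d s t ts
    using that by (auto simp: sorted_map intro: sorted_wrt_mono_rel)
  have 2: "(\<lambda>ts. map (\<lambda>\<tau>. c + \<tau>) ts) ` ?A s t = ?A (c + s) (c + t)"
  proof
    show "?A (c + s) (c + t) \<subseteq> map ((+) c) ` ?A s t"
    proof
      fix ts assume "ts \<in> ?A (c + s) (c + t)"
      then have "map (\<lambda>\<tau>. - c + \<tau>) ts \<in> ?A s t"
        using 1[of ts "c + s" "c + t" "- c"] by simp
      moreover have "ts = map (\<lambda>\<tau>. c + \<tau>) (map (\<lambda>\<tau>. - c + \<tau>) ts)"
        by (simp add: comp_def)
      ultimately show "ts \<in> map ((+) c) ` ?A s t" by blast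
    qed
  qed (use 1 in blast)
  show ?thesis
    unfolding curve_length_def 2[symmetric] image_image
    by (intro SUP_cong refl sum.cong) auto
qed

lemma is_curve_subcurve:
  assumes "is_curve \<gamma> l" "0 \<le> s" "s < t" "t \<le> l"
  shows "is_curve (\<lambda>\<tau>. \<gamma> (s + \<tau>)) (t - s)"
  using assms by (auto simp: is_curve_def curve_length_shift[of \<gamma> s])

text \<open>Nothing is known about \<open>\<gamma>\<close> outside [0,l], so the composition need
  not be Borel there. Clamping the parameter to [0,l] gives a Borel function on the whole line that
  agrees with it on the interval.\<close>

lemma curve_measurable:
  assumes "is_curve \<gamma> l" "g \<in> borel_measurable borel"
  obtains h :: "real \<Rightarrow> ennreal" where "h \<in> borel_measurable borel" "\<And>t. t \<in> {0..l} \<Longrightarrow> h t = g (\<gamma> t)"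
proof
  have "continuous_on UNIV (\<lambda>t. \<gamma> (max 0 (min l t)))"
    by (rule continuous_on_compose2[OF is_curve_continuous_on[OF assms(1)]])
      (use assms in \<open>auto simp: is_curve_def intro!: continuous_intros\<close>)
  then have "(\<lambda>t. \<gamma> (max 0 (min l t))) \<in> borel_measurable borel"
    by (rule borel_measurable_continuous_onI)
  then show "(\<lambda>t. g (\<gamma> (max 0 (min l t)))) \<in> borel_measurable borel"
    using assms(2) by measurable
qed auto

text \<open>Completing a measure does not change \<open>nn_integral\<close>. With the Borel
  extension from \<open>curve_measurable\<close> as \<open>h\<close>, curve integrals become
  integrals over \<open>lborel\<close>, where additivity and convergence theorems apply.\<close>

lemma curve_integral_eq:
  assumes "\<And>t. t \<in> {0..l} \<Longrightarrow> h t = g (\<gamma> t)"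
  shows "curve_integral g \<gamma> l = (\<integral>\<^sup>+t\<in>{0..l}. h t \<partial>lborel)"
  unfolding curve_integral_def nn_integral_completion
  by (intro nn_integral_cong) (auto simp: assms split: split_indicator)

lemma curve_integral_subcurve:
  assumes "\<And>t. t \<in> {0..l} \<Longrightarrow> h t = g (\<gamma> t)" "h \<in> borel_measurable borel" "0 \<le> s" "s \<le> t" "t \<le> l"
  shows "curve_integral g (\<lambda>\<tau>. \<gamma> (s + \<tau>)) (t - s) = (\<integral>\<^sup>+\<tau>\<in>{s..t}. h \<tau> \<partial>lborel)"
proof -
  have "(\<integral>\<^sup>+\<tau>\<in>{s..t}. h \<tau> \<partial>lborel) = (\<integral>\<^sup>+\<tau>. h (s + 1 * \<tau>) * indicator {s..t} (s + 1 * \<tau>) \<partial>lborel)"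
    using nn_integral_real_affine[of "\<lambda>\<tau>. h \<tau> * indicator {s..t} \<tau>" 1 s] assms(2) by simp
  also have "\<dots> = curve_integral g (\<lambda>\<tau>. \<gamma> (s + \<tau>)) (t - s)"
    unfolding curve_integral_def nn_integral_completion
    by (intro nn_integral_cong) (use assms in \<open>auto split: split_indicator\<close>)
  finally show ?thesis ..
qed

lemma curve_integral_mono:
  assumes "\<And>x. g x \<le> h x"
  shows "curve_integral g \<gamma> l \<le> curve_integral h \<gamma> l"
  unfolding curve_integral_def by (intro nn_integral_mono mult_right_mono) (auto simp: assms)

lemma curve_integral_cmult:
  assumes "is_curve \<gamma> l" "g \<in> borel_measurable borel"
  shows "curve_integral (\<lambda>x. c * g x) \<gamma> l = c * curve_integral g \<gamma> l"
proof -
  obtain h :: "real \<Rightarrow> ennreal" where [measurable]: "h \<in> borel_measurable borel"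
    and h: "\<And>t. t \<in> {0..l} \<Longrightarrow> h t = g (\<gamma> t)"
    using curve_measurable[OF assms] by blast
  have "curve_integral (\<lambda>x. c * g x) \<gamma> l = (\<integral>\<^sup>+t\<in>{0..l}. c * h t \<partial>lborel)"
    by (rule curve_integral_eq) (simp add: h)
  also have "\<dots> = c * (\<integral>\<^sup>+t\<in>{0..l}. h t \<partial>lborel)"
    by (simp add: mult.assoc nn_integral_cmult)
  finally show ?thesis
    using curve_integral_eq[of l h g \<gamma>, OF h] by simp
qed

section \<open>Minimal weak upper gradients\<close>

lemma set_nn_integral_lborel_combine:
  fixes w :: "real \<Rightarrow> ennreal"
  assumes [measurable]: "w \<in> borel_measurable borel" and "a \<le> b" "b \<le> c"
  shows "(\<integral>\<^sup>+t\<in>{a..b}. w t \<partial>lborel) + (\<integral>\<^sup>+t\<in>{b..c}. w t \<partial>lborel) = (\<integral>\<^sup>+t\<in>{a..c}. w t \<partial>lborel)"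
proof -
  have "(\<integral>\<^sup>+t\<in>{a..b}. w t \<partial>lborel) + (\<integral>\<^sup>+t\<in>{b..c}. w t \<partial>lborel)
      = (\<integral>\<^sup>+t. w t * indicator {a..b} t + w t * indicator {b..c} t \<partial>lborel)"
    by (rule nn_integral_add[symmetric]) auto
  \<comment> \<open>The common endpoint \<open>b\<close> is counted twice on the left, but it is a
    null set.\<close>
  also have "\<dots> = (\<integral>\<^sup>+t\<in>{a..c}. w t \<partial>lborel)"
    using AE_lborel_singleton[of b]
    by (intro nn_integral_cong_AE, eventually_elim) (use assms in \<open>auto split: split_indicator\<close>)
  finally show ?thesis .
qed

text \<open>\<open>D\<close> stands for the difference of a function between two parameters of a
  curve. Estimates on intervals shorter than \<open>e\<close> add up along a partition of [0,l] into
  \<open>n\<close> equal pieces, since \<open>D\<close> is subadditive and the integral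
  additive.\<close>

lemma subadditive_le_nn_integral_local:
  fixes D :: "real \<Rightarrow> real \<Rightarrow> ennreal"
  assumes "0 < l" and [measurable]: "w \<in> borel_measurable borel"
    and tri: "\<And>s t u. 0 \<le> s \<Longrightarrow> s < t \<Longrightarrow> t < u \<Longrightarrow> u \<le> l \<Longrightarrow> D s u \<le> D s t + D t u"
    and "0 < e"
    and local: "\<And>s t. 0 \<le> s \<Longrightarrow> s < t \<Longrightarrow> t \<le> l \<Longrightarrow> t - s < e \<Longrightarrow> D s t \<le> (\<integral>\<^sup>+\<tau>\<in>{s..t}. w \<tau> \<partial>lborel)"
  shows "D 0 l \<le> (\<integral>\<^sup>+\<tau>\<in>{0..l}. w \<tau> \<partial>lborel)"
proof -
  obtain n :: nat where n: "l / e < n"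
    using reals_Archimedean2 by blast
  with \<open>0 < l\<close> \<open>0 < e\<close> have "0 < n"
    by (metis divide_pos_pos gr0I less_trans of_nat_0 order_less_irrefl)
  define \<tau> where "\<tau> k = real k * l / n" for k :: nat
  have \<tau>_Suc: "\<tau> (Suc k) = \<tau> k + l / n" for k
    by (simp add: \<tau>_def add_divide_distrib distrib_right)
  have \<tau>_0: "\<tau> 0 = 0" and \<tau>_n: "\<tau> n = l"
    using \<open>0 < n\<close> by (auto simp: \<tau>_def)
  have step: "0 < l / n" "l / n < e"
    using n \<open>0 < n\<close> \<open>0 < l\<close> \<open>0 < e\<close> by (auto simp: field_simps)
  have \<tau>_pos: "0 < \<tau> (Suc k)" for k
    using \<open>0 < n\<close> \<open>0 < l\<close> by (simp add: \<tau>_def)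
  have \<tau>_le: "\<tau> k \<le> l" if "k \<le> n" for k
    using that \<open>0 < n\<close> \<open>0 < l\<close> by (simp add: \<tau>_def field_simps)
  \<comment> \<open>The induction starts from one piece rather than none, because
    \<open>local\<close> needs a nondegenerate interval.\<close>
  have "D 0 (\<tau> (Suc k)) \<le> (\<integral>\<^sup>+t\<in>{0..\<tau> (Suc k)}. w t \<partial>lborel)" if "Suc k \<le> n" for k
    using that
  proof (induction k)
    case 0
    then show ?case
      using local[of 0 "\<tau> 1"] step \<tau>_le[of 1] by (simp add: \<tau>_Suc \<tau>_0)
  next
    case (Suc k)
    let ?s = "\<tau> (Suc k)" and ?t = "\<tau> (Suc (Suc k))"
    have st: "0 < ?s" "?s < ?t" "?t \<le> l" "?t - ?s < e"
      using step \<tau>_pos[of k] \<tau>_le[OF Suc.prems] \<tau>_Suc[of "Suc k"] by simp_all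
    have "D 0 ?t \<le> D 0 ?s + D ?s ?t"
      using tri st by simp
    also have "\<dots> \<le> (\<integral>\<^sup>+t\<in>{0..?s}. w t \<partial>lborel) + (\<integral>\<^sup>+t\<in>{?s..?t}. w t \<partial>lborel)"
      using Suc st local by (intro add_mono) auto
    also have "\<dots> = (\<integral>\<^sup>+t\<in>{0..?t}. w t \<partial>lborel)"
      using st by (intro set_nn_integral_lborel_combine) auto
    finally show ?case .
  qed
  from this[of "n - 1"] show ?thesis
    using \<open>0 < n\<close> by (simp add: \<tau>_n)
qed

text \<open>
  A compact \<open>K\<close> inside and an open \<open>V\<close> around it approximate \<open>{h1 \<le> h2}\<close>: short intervals
  meeting \<open>K\<close> stay in \<open>V\<close> and are estimated with \<open>h1\<close>, all others with \<open>h2\<close>.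
\<close>

lemma subadditive_le_nn_integral_min:
  fixes D :: "real \<Rightarrow> real \<Rightarrow> ennreal"
  assumes "0 < l" and [measurable]: "h1 \<in> borel_measurable borel" "h2 \<in> borel_measurable borel"
    and fin: "(\<integral>\<^sup>+\<tau>\<in>{0..l}. h1 \<tau> \<partial>lborel) < \<infinity>" "(\<integral>\<^sup>+\<tau>\<in>{0..l}. h2 \<tau> \<partial>lborel) < \<infinity>"
    and tri: "\<And>s t u. 0 \<le> s \<Longrightarrow> s < t \<Longrightarrow> t < u \<Longrightarrow> u \<le> l \<Longrightarrow> D s u \<le> D s t + D t u"
    and h1: "\<And>s t. 0 \<le> s \<Longrightarrow> s < t \<Longrightarrow> t \<le> l \<Longrightarrow> D s t \<le> (\<integral>\<^sup>+\<tau>\<in>{s..t}. h1 \<tau> \<partial>lborel)"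
    and h2: "\<And>s t. 0 \<le> s \<Longrightarrow> s < t \<Longrightarrow> t \<le> l \<Longrightarrow> D s t \<le> (\<integral>\<^sup>+\<tau>\<in>{s..t}. h2 \<tau> \<partial>lborel)"
  shows "D 0 l \<le> (\<integral>\<^sup>+\<tau>\<in>{0..l}. min (h1 \<tau>) (h2 \<tau>) \<partial>lborel)"
proof (rule ennreal_le_epsilon)
  fix e :: real assume "0 < e"
  \<comment> \<open>The cutoff outside [0,l] makes \<open>N\<close> finite, hence regular, and
    \<open>N\<close> controls \<open>h1\<close> and \<open>h2\<close> on [0,l] at the same
    time.\<close>
  define h where "h t = (h1 t + h2 t) * indicator {0..l} t" for t
  have [measurable]: "h \<in> borel_measurable borel"
    unfolding h_def by measurable
  define N where "N = density lborel h"
  have sets_N: "sets N = sets borel" by (simp add: N_def)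
  have N: "emeasure N S = (\<integral>\<^sup>+t\<in>S. h t \<partial>lborel)" if "S \<in> sets borel" for S
    unfolding N_def using that by (intro emeasure_density) auto
  have "emeasure N UNIV = (\<integral>\<^sup>+\<tau>\<in>{0..l}. h1 \<tau> \<partial>lborel) + (\<integral>\<^sup>+\<tau>\<in>{0..l}. h2 \<tau> \<partial>lborel)"
    by (simp add: N h_def distrib_right nn_integral_add)
  with fin have N_fin: "emeasure N S < \<infinity>" for S
    using emeasure_space[of N S] by (simp add: N_def le_less_trans)
  define A where "A = {t. h1 t \<le> h2 t}"
  have [measurable]: "A \<in> sets borel"
    unfolding A_def by measurable
  have "\<exists>K\<in>{K. K \<subseteq> A \<and> compact K}. emeasure N A < emeasure N K + ennreal (e / 2)"
    by (rule SUP_approx_ennreal[OF _ _ inner_regular]) (use \<open>0 < e\<close> N_fin sets_N in \<open>auto simp: less_top[symmetric]\<close>)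
  then obtain K where K: "K \<subseteq> A" "compact K" "emeasure N A < emeasure N K + ennreal (e / 2)"
    by blast
  have [measurable]: "K \<in> sets borel"
    using \<open>compact K\<close> by (simp add: compact_imp_closed)
  have "\<exists>V\<in>{V. K \<subseteq> V \<and> open V}. emeasure N V < emeasure N K + ennreal (e / 2)"
    by (rule INF_approx_ennreal[OF _ outer_regular]) (use \<open>0 < e\<close> N_fin sets_N in \<open>auto simp: less_top[symmetric]\<close>)
  then obtain V where V: "K \<subseteq> V" "open V" "emeasure N V < emeasure N K + ennreal (e / 2)"
    by blast
  have [measurable]: "V \<in> sets borel"
    using \<open>open V\<close> by simp
  have diff: "emeasure N (S - K) \<le> ennreal (e / 2)"
    if "K \<subseteq> S" "S \<in> sets borel" "emeasure N S < emeasure N K + ennreal (e / 2)" for S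
    using that N_fin[of K] by (auto simp: emeasure_Diff sets_N ennreal_minus_le_iff less_imp_le)
  \<comment> \<open>Both terms are present on \<open>V - K\<close>; the excess over the minimum is
    charged to the small mass \<open>N (V - K)\<close>.\<close>
  define w where "w t = h1 t * indicator V t + h2 t * indicator (- K) t" for t
  have [measurable]: "w \<in> borel_measurable borel"
    unfolding w_def by measurable
  obtain d where d: "0 < d" "(\<Union>x\<in>K. ball x d) \<subseteq> V"
    using compact_subset_open_imp_ball_epsilon_subset[OF \<open>compact K\<close> \<open>open V\<close> \<open>K \<subseteq> V\<close>] by blast
  have "D 0 l \<le> (\<integral>\<^sup>+\<tau>\<in>{0..l}. w \<tau> \<partial>lborel)"
  proof (rule subadditive_le_nn_integral_local[OF \<open>0 < l\<close> _ tri \<open>0 < d\<close>])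
    fix s t :: real assume st: "0 \<le> s" "s < t" "t \<le> l" "t - s < d"
    show "D s t \<le> (\<integral>\<^sup>+\<tau>\<in>{s..t}. w \<tau> \<partial>lborel)"
    proof (cases "{s..t} \<inter> K = {}")
      case True
      then have "(\<integral>\<^sup>+\<tau>\<in>{s..t}. h2 \<tau> \<partial>lborel) \<le> (\<integral>\<^sup>+\<tau>\<in>{s..t}. w \<tau> \<partial>lborel)"
        by (intro nn_integral_mono) (auto simp: w_def split: split_indicator)
      with h2 st show ?thesis by (meson order_trans)
    next
      case False
      then obtain x where "x \<in> K" "s \<le> x" "x \<le> t" by auto
      with st have "{s..t} \<subseteq> ball x d"
        by (auto simp: dist_real_def)
      with d \<open>x \<in> K\<close> have "{s..t} \<subseteq> V" by blast
      then have "(\<integral>\<^sup>+\<tau>\<in>{s..t}. h1 \<tau> \<partial>lborel) \<le> (\<integral>\<^sup>+\<tau>\<in>{s..t}. w \<tau> \<partial>lborel)"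
        by (intro nn_integral_mono) (auto simp: w_def split: split_indicator)
      with h1 st show ?thesis by (meson order_trans)
    qed
  qed auto
  \<comment> \<open>Three cases on [0,l]. On \<open>K\<close> the weight is \<open>h1\<close>, which
    is the minimum there. On \<open>V - K\<close> it is \<open>h1 + h2\<close>, that is
    \<open>h\<close>. Off \<open>V\<close> it is \<open>h2\<close>, which exceeds the minimum only
    on \<open>A - K\<close>.\<close>
  also have "\<dots> \<le> (\<integral>\<^sup>+\<tau>. min (h1 \<tau>) (h2 \<tau>) * indicator {0..l} \<tau>
      + (h \<tau> * indicator (V - K) \<tau> + h \<tau> * indicator (A - K) \<tau>) \<partial>lborel)"
    using \<open>K \<subseteq> A\<close> \<open>K \<subseteq> V\<close>
    by (intro nn_integral_mono) (auto simp: w_def h_def A_def min_def split: split_indicator)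
  also have "\<dots> = (\<integral>\<^sup>+\<tau>\<in>{0..l}. min (h1 \<tau>) (h2 \<tau>) \<partial>lborel) + (emeasure N (V - K) + emeasure N (A - K))"
    by (simp add: nn_integral_add N)
  also have "\<dots> \<le> (\<integral>\<^sup>+\<tau>\<in>{0..l}. min (h1 \<tau>) (h2 \<tau>) \<partial>lborel) + (ennreal (e / 2) + ennreal (e / 2))"
    using K V by (intro add_mono diff order_refl) auto
  also have "ennreal (e / 2) + ennreal (e / 2) = ennreal e"
    using \<open>0 < e\<close> by (simp flip: ennreal_plus)
  finally show "D 0 l \<le> (\<integral>\<^sup>+\<tau>\<in>{0..l}. min (h1 \<tau>) (h2 \<tau>) \<partial>lborel) + ennreal e" .
qed

section \<open>Borel representatives of weak upper gradients\<close>

lemma metric_measure_space_measurable: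
  assumes "metric_measure_space M"
  shows "f \<in> borel_measurable borel \<Longrightarrow> f \<in> borel_measurable M"
    and "S \<in> sets borel \<Longrightarrow> S \<in> sets M"
    and "space M = UNIV"
proof -
  obtain N where N: "sets N = sets borel" "M = completion N"
    using assms by (auto simp: metric_measure_space_def)
  show "f \<in> borel_measurable borel \<Longrightarrow> f \<in> borel_measurable M"
    using N by (auto intro!: measurable_completion simp: measurable_cong_sets[of N borel])
  show "S \<in> sets borel \<Longrightarrow> S \<in> sets M"
    using N by auto
  show "space M = UNIV"
    using N sets_eq_imp_space_eq[of N borel] by simp
qed

text \<open>A function measurable for the completion agrees with a Borel one off a Borel null set.
  Raising the value to \<open>top\<close> on that set gives domination everywhere, so curve
  inequalities persist while integrals over \<open>M\<close> stay the same.\<close>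

lemma borel_majorant:
  assumes "metric_measure_space M" "g \<in> borel_measurable M"
  obtains g' :: "'a::metric_space \<Rightarrow> ennreal"
    where "g' \<in> borel_measurable borel" "\<And>x. g x \<le> g' x" "AE x in M. g' x = g x"
proof -
  obtain N where N: "sets N = sets borel" "M = completion N"
    using assms by (auto simp: metric_measure_space_def)
  with assms obtain g1 where g1: "g1 \<in> borel_measurable N" "AE x in N. g x = g1 x"
    using completion_ex_borel_measurable by blast
  then obtain Z where Z: "{x \<in> space N. g x \<noteq> g1 x} \<subseteq> Z" "Z \<in> null_sets N"
    unfolding eventually_ae_filter by blast
  define g' where "g' x = (if x \<in> Z then top else g1 x)" for x
  show ?thesis
  proof
    have [measurable]: "Z \<in> sets N" "g1 \<in> borel_measurable N"
      using g1 Z by auto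
    have "g' \<in> borel_measurable N"
      unfolding g'_def by measurable
    then show "g' \<in> borel_measurable borel"
      using measurable_cong_sets[OF N(1) refl] by blast
    have "space N = UNIV"
      using N(1) sets_eq_imp_space_eq by fastforce
    with Z(1) have "x \<in> Z \<or> g x = g1 x" for x
      by blast
    then show "g x \<le> g' x" for x
      by (metis g'_def order_refl top_greatest)
    have "AE x in N. x \<notin> Z"
      using Z AE_not_in by blast
    with g1(2) have "AE x in N. g' x = g x"
      by eventually_elim (simp add: g'_def)
    then show "AE x in M. g' x = g x"
      using N AE_completion by blast
  qed
qed

text \<open>
  A Borel \<open>p\<close>-weak upper gradient \<open>g\<close> in \<open>L\<^sup>p\<close> together with an \<open>L\<^sup>p\<close> function \<open>\<rho> \<ge> g\<close>
  witnessing that the bad curves are exceptional.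
\<close>

definition borel_wug ::
  "'a::metric_space measure \<Rightarrow> real \<Rightarrow> ('a \<Rightarrow> ereal) \<Rightarrow> ('a \<Rightarrow> ennreal) \<Rightarrow> ('a \<Rightarrow> ennreal) \<Rightarrow> bool" where
  "borel_wug M p f g \<rho> \<longleftrightarrow>
     g \<in> borel_measurable borel \<and> \<rho> \<in> borel_measurable borel \<and>
     (\<integral>\<^sup>+x. epowr (\<rho> x) p \<partial>M) < \<infinity> \<and> (\<forall>x. g x \<le> \<rho> x) \<and>
     (\<forall>\<gamma> l. is_curve \<gamma> l \<and> curve_integral \<rho> \<gamma> l < \<infinity> \<longrightarrow> ug_inequality f g \<gamma> l)"

lemma borel_wug_imp_weak_upper_gradient:
  assumes "metric_measure_space M" "borel_wug M p f g \<rho>"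
  shows "weak_upper_gradient M p f g"
  unfolding weak_upper_gradient_def exceptional_family_def in_Lp_def
proof (intro conjI exI[of _ \<rho>])
  show "\<forall>(\<gamma>, l)\<in>{(\<gamma>, l). is_curve \<gamma> l \<and> \<not> ug_inequality f g \<gamma> l}. curve_integral \<rho> \<gamma> l = \<infinity>"
    using assms(2) by (force simp: borel_wug_def less_top[symmetric])
qed (use assms metric_measure_space_measurable[OF assms(1)] in \<open>auto simp: borel_wug_def\<close>)

lemma nn_integral_epowr_max_finite:
  assumes [measurable]: "f \<in> borel_measurable M" "g \<in> borel_measurable M"
    and "(\<integral>\<^sup>+x. epowr (f x) p \<partial>M) < \<infinity>" "(\<integral>\<^sup>+x. epowr (g x) p \<partial>M) < \<infinity>"
  shows "(\<integral>\<^sup>+x. epowr (max (f x) (g x)) p \<partial>M) < \<infinity>"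
proof -
  have "(\<integral>\<^sup>+x. epowr (max (f x) (g x)) p \<partial>M) \<le> (\<integral>\<^sup>+x. epowr (f x) p + epowr (g x) p \<partial>M)"
    by (intro nn_integral_mono epowr_max_le)
  also have "\<dots> < \<infinity>"
    using assms by (simp add: nn_integral_add)
  finally show ?thesis .
qed

lemma ug_inequality_mono:
  assumes "ug_inequality f g \<gamma> l" "\<And>x. g x \<le> h x"
  shows "ug_inequality f h \<gamma> l"
  using assms curve_integral_mono[of g h] unfolding ug_inequality_def by (meson order_trans)

text \<open>Enlarging \<open>g\<close> and the witness everywhere keeps the inequality along good
  curves and the infinite integral along bad ones.\<close>

lemma weak_upper_gradient_borel:
  assumes M: "metric_measure_space M" and "weak_upper_gradient M p f g" "in_Lp M p g"
  obtains g' \<rho> where "borel_wug M p f g' \<rho>" "\<And>x. g x \<le> g' x" "AE x in M. g' x = g x"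
proof -
  obtain \<rho>0 where \<rho>0: "in_Lp M p \<rho>0"
    and "\<forall>(\<gamma>, l)\<in>{(\<gamma>, l). is_curve \<gamma> l \<and> \<not> ug_inequality f g \<gamma> l}. curve_integral \<rho>0 \<gamma> l = \<infinity>"
    using assms(2) unfolding weak_upper_gradient_def exceptional_family_def by (elim conjE exE)
  then have *: "curve_integral \<rho>0 \<gamma> l = \<infinity>" if "is_curve \<gamma> l" "\<not> ug_inequality f g \<gamma> l" for \<gamma> l
    using that by simp
  obtain g' where g': "g' \<in> borel_measurable borel" "\<And>x. g x \<le> g' x" "AE x in M. g' x = g x"
    using borel_majorant[OF M] assms(3) unfolding in_Lp_def by metis
  obtain \<rho>1 where \<rho>1: "\<rho>1 \<in> borel_measurable borel" "\<And>x. \<rho>0 x \<le> \<rho>1 x" "AE x in M. \<rho>1 x = \<rho>0 x"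
    using borel_majorant[OF M] \<rho>0 unfolding in_Lp_def by metis
  have fin: "(\<integral>\<^sup>+x. epowr (g' x) p \<partial>M) < \<infinity>" "(\<integral>\<^sup>+x. epowr (\<rho>1 x) p \<partial>M) < \<infinity>"
  proof -
    have "(\<integral>\<^sup>+x. epowr (g' x) p \<partial>M) = (\<integral>\<^sup>+x. epowr (g x) p \<partial>M)"
      by (intro nn_integral_cong_AE, use g'(3) in eventually_elim) simp
    moreover have "(\<integral>\<^sup>+x. epowr (\<rho>1 x) p \<partial>M) = (\<integral>\<^sup>+x. epowr (\<rho>0 x) p \<partial>M)"
      by (intro nn_integral_cong_AE, use \<rho>1(3) in eventually_elim) simp
    ultimately show "(\<integral>\<^sup>+x. epowr (g' x) p \<partial>M) < \<infinity>" "(\<integral>\<^sup>+x. epowr (\<rho>1 x) p \<partial>M) < \<infinity>"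
      using assms(3) \<rho>0 by (auto simp: in_Lp_def)
  qed
  \<comment> \<open>Including \<open>g'\<close> in the witness gives \<open>g'\<close> a finite
    integral along every good curve.\<close>
  have "borel_wug M p f g' (\<lambda>x. max (\<rho>1 x) (g' x))"
    unfolding borel_wug_def
  proof (intro conjI allI impI)
    show "(\<integral>\<^sup>+x. epowr (max (\<rho>1 x) (g' x)) p \<partial>M) < \<infinity>"
      using fin g'(1) \<rho>1(1)
      by (intro nn_integral_epowr_max_finite metric_measure_space_measurable(1)[OF M])
    fix \<gamma> l assume c: "is_curve \<gamma> l \<and> curve_integral (\<lambda>x. max (\<rho>1 x) (g' x)) \<gamma> l < \<infinity>"
    have "curve_integral \<rho>0 \<gamma> l \<le> curve_integral (\<lambda>x. max (\<rho>1 x) (g' x)) \<gamma> l"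
      by (intro curve_integral_mono) (use \<rho>1(2) le_max_iff_disj in blast)
    with c have "curve_integral \<rho>0 \<gamma> l \<noteq> \<infinity>"
      by (auto simp: top_unique)
    with * c have "ug_inequality f g \<gamma> l" by blast
    then show "ug_inequality f g' \<gamma> l"
      using g'(2) by (rule ug_inequality_mono)
  qed (use g'(1) \<rho>1(1) in auto)
  then show ?thesis using that g' by blast
qed

text \<open>Which function is the smaller one may change along a curve, so the inequalities for the
  whole curve do not suffice. But a finite integral of the witness is inherited by subcurves, so
  both inequalities hold on every parameter interval, as
  \<open>subadditive_le_nn_integral_min\<close> requires.\<close>

lemma borel_wug_min:
  assumes M: "metric_measure_space M"
    and 1: "borel_wug M p f g1 \<rho>1" and 2: "borel_wug M p f g2 \<rho>2"
  shows "borel_wug M p f (\<lambda>x. min (g1 x) (g2 x)) (\<lambda>x. max (\<rho>1 x) (\<rho>2 x))"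
  unfolding borel_wug_def
proof (intro conjI allI impI)
  show "(\<integral>\<^sup>+x. epowr (max (\<rho>1 x) (\<rho>2 x)) p \<partial>M) < \<infinity>"
    using 1 2 by (intro nn_integral_epowr_max_finite metric_measure_space_measurable(1)[OF M])
      (auto simp: borel_wug_def)
  fix \<gamma> l assume c: "is_curve \<gamma> l \<and> curve_integral (\<lambda>x. max (\<rho>1 x) (\<rho>2 x)) \<gamma> l < \<infinity>"
  then have "is_curve \<gamma> l" by simp
  then have "0 < l" by (simp add: is_curve_def)
  have step: "\<exists>h\<in>borel_measurable borel. (\<forall>t\<in>{0..l}. h t = g (\<gamma> t)) \<and> (\<integral>\<^sup>+\<tau>\<in>{0..l}. h \<tau> \<partial>lborel) < \<infinity> \<and>
      (\<forall>s t. 0 \<le> s \<longrightarrow> s < t \<longrightarrow> t \<le> l \<longrightarrow> endpoint_diff (f (\<gamma> s)) (f (\<gamma> t)) \<le> (\<integral>\<^sup>+\<tau>\<in>{s..t}. h \<tau> \<partial>lborel))"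
    if g: "borel_wug M p f g \<rho>" and le: "\<And>x. \<rho> x \<le> max (\<rho>1 x) (\<rho>2 x)" for g \<rho>
  proof -
    obtain h where h: "h \<in> borel_measurable borel" "\<And>t. t \<in> {0..l} \<Longrightarrow> h t = g (\<gamma> t)"
      using curve_measurable[OF \<open>is_curve \<gamma> l\<close>, of g] g by (auto simp: borel_wug_def)
    obtain k where k: "k \<in> borel_measurable borel" "\<And>t. t \<in> {0..l} \<Longrightarrow> k t = \<rho> (\<gamma> t)"
      using curve_measurable[OF \<open>is_curve \<gamma> l\<close>, of \<rho>] g by (auto simp: borel_wug_def)
    have "curve_integral \<rho> \<gamma> l \<le> curve_integral (\<lambda>x. max (\<rho>1 x) (\<rho>2 x)) \<gamma> l"
      by (intro curve_integral_mono le)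
    with c have fin: "curve_integral \<rho> \<gamma> l < \<infinity>"
      by (meson le_less_trans)
    have "curve_integral g \<gamma> l \<le> curve_integral \<rho> \<gamma> l"
      using g by (intro curve_integral_mono) (auto simp: borel_wug_def)
    with fin have "(\<integral>\<^sup>+\<tau>\<in>{0..l}. h \<tau> \<partial>lborel) < \<infinity>"
      using curve_integral_eq[of l h g \<gamma>, OF h(2)] by (metis le_less_trans)
    moreover have "endpoint_diff (f (\<gamma> s)) (f (\<gamma> t)) \<le> (\<integral>\<^sup>+\<tau>\<in>{s..t}. h \<tau> \<partial>lborel)"
      if st: "0 \<le> s" "s < t" "t \<le> l" for s t
    proof -
      let ?\<gamma> = "\<lambda>\<tau>. \<gamma> (s + \<tau>)"
      have "curve_integral \<rho> ?\<gamma> (t - s) = (\<integral>\<^sup>+\<tau>\<in>{s..t}. k \<tau> \<partial>lborel)"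
        using k st by (intro curve_integral_subcurve) auto
      also have "\<dots> \<le> (\<integral>\<^sup>+\<tau>\<in>{0..l}. k \<tau> \<partial>lborel)"
        using st by (intro nn_integral_mono) (auto split: split_indicator)
      also have "\<dots> < \<infinity>"
        using fin curve_integral_eq[of l k \<rho> \<gamma>, OF k(2)] by simp
      finally have "ug_inequality f g ?\<gamma> (t - s)"
        using g is_curve_subcurve[OF \<open>is_curve \<gamma> l\<close>] st by (auto simp: borel_wug_def)
      then show ?thesis
        using curve_integral_subcurve[of l h g \<gamma> s t] h st by (simp add: ug_inequality_def)
    qed
    ultimately show ?thesis
      using h by blast
  qed
  obtain h1 where h1: "h1 \<in> borel_measurable borel" "\<forall>t\<in>{0..l}. h1 t = g1 (\<gamma> t)"
    "(\<integral>\<^sup>+\<tau>\<in>{0..l}. h1 \<tau> \<partial>lborel) < \<infinity>"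
    "\<And>s t. 0 \<le> s \<Longrightarrow> s < t \<Longrightarrow> t \<le> l \<Longrightarrow> endpoint_diff (f (\<gamma> s)) (f (\<gamma> t)) \<le> (\<integral>\<^sup>+\<tau>\<in>{s..t}. h1 \<tau> \<partial>lborel)"
    using step[OF 1] by fastforce
  obtain h2 where h2: "h2 \<in> borel_measurable borel" "\<forall>t\<in>{0..l}. h2 t = g2 (\<gamma> t)"
    "(\<integral>\<^sup>+\<tau>\<in>{0..l}. h2 \<tau> \<partial>lborel) < \<infinity>"
    "\<And>s t. 0 \<le> s \<Longrightarrow> s < t \<Longrightarrow> t \<le> l \<Longrightarrow> endpoint_diff (f (\<gamma> s)) (f (\<gamma> t)) \<le> (\<integral>\<^sup>+\<tau>\<in>{s..t}. h2 \<tau> \<partial>lborel)"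
    using step[OF 2] by fastforce
  have "endpoint_diff (f (\<gamma> 0)) (f (\<gamma> l)) \<le> (\<integral>\<^sup>+\<tau>\<in>{0..l}. min (h1 \<tau>) (h2 \<tau>) \<partial>lborel)"
    using h1 h2 \<open>0 < l\<close>
    by (intro subadditive_le_nn_integral_min[where D = "\<lambda>s t. endpoint_diff (f (\<gamma> s)) (f (\<gamma> t))"])
      (auto intro: endpoint_diff_triangle)
  also have "\<dots> = curve_integral (\<lambda>x. min (g1 x) (g2 x)) \<gamma> l"
    using h1(2) h2(2) by (intro curve_integral_eq[symmetric]) auto
  finally show "ug_inequality f (\<lambda>x. min (g1 x) (g2 x)) \<gamma> l"
    by (simp add: ug_inequality_def)
next
  have "g1 x \<le> \<rho>1 x" for x
    using 1 by (simp add: borel_wug_def)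
  then show "min (g1 x) (g2 x) \<le> max (\<rho>1 x) (\<rho>2 x)" for x
    by (meson max.coboundedI1 min.coboundedI1)
  have [measurable]: "g1 \<in> borel_measurable borel" "g2 \<in> borel_measurable borel"
    "\<rho>1 \<in> borel_measurable borel" "\<rho>2 \<in> borel_measurable borel"
    using 1 2 by (simp_all add: borel_wug_def)
  show "(\<lambda>x. min (g1 x) (g2 x)) \<in> borel_measurable borel" "(\<lambda>x. max (\<rho>1 x) (\<rho>2 x)) \<in> borel_measurable borel"
    by measurable
qed

section \<open>Decreasing limits and the energy minimizer\<close>

text \<open>Summing weighted \<open>p\<close>-th powers and taking the root makes the energy of
  \<open>\<sigma>\<close> computable term by term, without Minkowski's inequality. The purpose is a
  common witness for countably many exceptional families: if \<open>\<sigma>\<close> has finite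
  integral along a curve, so has every \<open>\<rho> n\<close>.\<close>

lemma exists_dominating_Lp:
  fixes \<rho> :: "nat \<Rightarrow> 'a::topological_space \<Rightarrow> ennreal"
  assumes p: "0 < p" and M: "\<And>f :: 'a \<Rightarrow> ennreal. f \<in> borel_measurable borel \<Longrightarrow> f \<in> borel_measurable M"
    and [measurable]: "\<And>n. \<rho> n \<in> borel_measurable borel"
    and fin: "\<And>n. (\<integral>\<^sup>+x. epowr (\<rho> n x) p \<partial>M) < \<infinity>"
  obtains \<sigma> :: "'a \<Rightarrow> ennreal" and c :: "nat \<Rightarrow> real"
  where "\<sigma> \<in> borel_measurable borel" "(\<integral>\<^sup>+x. epowr (\<sigma> x) p \<partial>M) < \<infinity>"
    "\<And>n. 0 < c n" "\<And>n x. ennreal (c n) * \<rho> n x \<le> \<sigma> x"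
proof -
  define I where "I n = enn2real (\<integral>\<^sup>+x. epowr (\<rho> n x) p \<partial>M)" for n
  have I: "(\<integral>\<^sup>+x. epowr (\<rho> n x) p \<partial>M) = ennreal (I n)" "0 \<le> I n" for n
    using fin[of n] by (auto simp: I_def)
  \<comment> \<open>With this weight the \<open>n\<close>-th term of the energy is at most
    \<open>(1 / 2) ^ n\<close>; the summand 1 keeps the weight positive when
    \<open>I n = 0\<close>.\<close>
  define b where "b n = (1 / 2) ^ n / (1 + I n)" for n
  have b: "0 < b n" for n
    using I(2)[of n] by (simp add: b_def)
  define \<sigma> where "\<sigma> x = epowr (\<Sum>n. ennreal (b n) * epowr (\<rho> n x) p) (1 / p)" for x
  have root: "epowr (epowr y (1 / p)) p = y" for y
    using p by (cases y) (auto simp: epowr_ennreal powr_powr)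
  have \<sigma>: "epowr (\<sigma> x) p = (\<Sum>n. ennreal (b n) * epowr (\<rho> n x) p)" for x
    by (simp add: \<sigma>_def root)
  have [measurable]: "(\<lambda>x. epowr (\<rho> n x) p) \<in> borel_measurable M" for n
    by (rule M) measurable
  show ?thesis
  proof
    show "\<sigma> \<in> borel_measurable borel"
      unfolding \<sigma>_def by measurable
    have "(\<integral>\<^sup>+x. epowr (\<sigma> x) p \<partial>M) = (\<Sum>n. ennreal (b n) * ennreal (I n))"
      by (simp add: \<sigma> nn_integral_suminf nn_integral_cmult I)
    also have "\<dots> \<le> (\<Sum>n. ennreal ((1 / 2) ^ n))"
    proof (rule suminf_le)
      show "ennreal (b n) * ennreal (I n) \<le> ennreal ((1 / 2) ^ n)" for n
        using I(2)[of n] b[of n] by (auto simp: ennreal_mult[symmetric] b_def field_simps intro!: ennreal_leI)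
    qed auto
    also have "\<dots> < \<infinity>"
      by (simp add: less_top[symmetric] ennreal_suminf_neq_top)
    finally show "(\<integral>\<^sup>+x. epowr (\<sigma> x) p \<partial>M) < \<infinity>" .
    show "0 < b n powr (1 / p)" for n
      using b[of n] by simp
    show "ennreal (b n powr (1 / p)) * \<rho> n x \<le> \<sigma> x" for n x
    proof (rule ccontr)
      \<comment> \<open>\<open>epowr_mono\<close> turns the strict failure into equality of the
        \<open>p\<close>-th powers, which injectivity excludes.\<close>
      assume *: "\<not> ?thesis"
      have "epowr (ennreal (b n powr (1 / p)) * \<rho> n x) p = ennreal (b n) * epowr (\<rho> n x) p"
        using b[of n] p by (simp add: epowr_cmult powr_powr)
      also have "\<dots> \<le> epowr (\<sigma> x) p"
        unfolding \<sigma> by (rule sum_le_suminf[of _ "{n}", simplified]) auto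
      finally have "epowr (ennreal (b n powr (1 / p)) * \<rho> n x) p = epowr (\<sigma> x) p"
        using * epowr_mono[OF p, of "\<sigma> x" "ennreal (b n powr (1 / p)) * \<rho> n x"] by (simp add: not_le less_imp_le antisym)
      with * show False
        by (simp add: epowr_eq_iff[OF p])
    qed
  qed
qed

text \<open>Along a curve where every \<open>\<rho> n\<close> has finite integral, the integrals of
  the decreasing \<open>g n\<close> are finite and converge to that of the infimum, so the upper
  gradient inequality survives.\<close>

lemma borel_wug_INF:
  assumes M: "metric_measure_space M" and p: "0 < p"
    and g: "\<And>n. borel_wug M p f (g n) (\<rho> n)" and dec: "\<And>n x. g (Suc n) x \<le> g n x"
  obtains \<sigma> where "borel_wug M p f (\<lambda>x. INF n. g n x) \<sigma>"
proof -
  have [measurable]: "g n \<in> borel_measurable borel" "\<rho> n \<in> borel_measurable borel" for n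
    using g by (auto simp: borel_wug_def)
  have \<rho>: "(\<integral>\<^sup>+x. epowr (\<rho> n x) p \<partial>M) < \<infinity>" "g n x \<le> \<rho> n x" for n x
    using g by (auto simp: borel_wug_def)
  obtain \<sigma> c where [measurable]: "\<sigma> \<in> borel_measurable borel" and \<sigma>: "(\<integral>\<^sup>+x. epowr (\<sigma> x) p \<partial>M) < \<infinity>"
    and c: "\<And>n. 0 < c n" "\<And>n x. ennreal (c n) * \<rho> n x \<le> \<sigma> x"
    using exists_dominating_Lp[OF p metric_measure_space_measurable(1)[OF M], of \<rho>] \<rho>(1) by auto
  \<comment> \<open>\<open>\<sigma>\<close> makes every \<open>\<rho> n\<close> integrable along
    good curves. \<open>\<rho> 0\<close> is added to dominate the infimum pointwise, which
    \<open>\<sigma>\<close> does only up to the factors \<open>c n\<close>.\<close>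
  have "borel_wug M p f (\<lambda>x. INF n. g n x) (\<lambda>x. max (\<sigma> x) (\<rho> 0 x))"
    unfolding borel_wug_def
  proof (intro conjI allI impI)
    show "(\<integral>\<^sup>+x. epowr (max (\<sigma> x) (\<rho> 0 x)) p \<partial>M) < \<infinity>"
      using \<sigma> \<rho> by (intro nn_integral_epowr_max_finite metric_measure_space_measurable(1)[OF M]) auto
    show "(INF n. g n x) \<le> max (\<sigma> x) (\<rho> 0 x)" for x
      using \<rho>(2)[of 0 x] by (meson INF_lower2 UNIV_I max.coboundedI2)
    fix \<gamma> l assume "is_curve \<gamma> l \<and> curve_integral (\<lambda>x. max (\<sigma> x) (\<rho> 0 x)) \<gamma> l < \<infinity>"
    then have \<gamma>: "is_curve \<gamma> l" and max: "curve_integral (\<lambda>x. max (\<sigma> x) (\<rho> 0 x)) \<gamma> l < \<infinity>"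
      by auto
    have fin: "curve_integral (\<rho> n) \<gamma> l < \<infinity>" for n
    proof -
      have "ennreal (c n) * curve_integral (\<rho> n) \<gamma> l = curve_integral (\<lambda>x. ennreal (c n) * \<rho> n x) \<gamma> l"
        using \<gamma> by (simp add: curve_integral_cmult)
      also have "\<dots> \<le> curve_integral (\<lambda>x. max (\<sigma> x) (\<rho> 0 x)) \<gamma> l"
        using c(2) by (intro curve_integral_mono) (meson max.coboundedI1)
      finally have "ennreal (c n) * curve_integral (\<rho> n) \<gamma> l < \<infinity>"
        using max by (rule le_less_trans)
      then show ?thesis
        using c(1)[of n] by (auto simp: ennreal_mult_less_top)
    qed
    have ug: "endpoint_diff (f (\<gamma> 0)) (f (\<gamma> l)) \<le> curve_integral (g n) \<gamma> l" for n
      using g[of n] \<gamma> fin[of n] by (auto simp: borel_wug_def ug_inequality_def)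
    have "\<exists>h. \<forall>n. h n \<in> borel_measurable borel \<and> (\<forall>t\<in>{0..l}. h n t = g n (\<gamma> t))"
    proof (rule choice, rule allI)
      fix n
      obtain k :: "real \<Rightarrow> ennreal"
        where "k \<in> borel_measurable borel" "\<And>t. t \<in> {0..l} \<Longrightarrow> k t = g n (\<gamma> t)"
        by (rule curve_measurable[OF \<gamma>, of "g n"]) auto
      then show "\<exists>k. k \<in> borel_measurable borel \<and> (\<forall>t\<in>{0..l}. k t = g n (\<gamma> t))"
        by blast
    qed
    then obtain h where h [measurable]: "\<And>n. h n \<in> borel_measurable borel"
      and hg: "\<And>n t. t \<in> {0..l} \<Longrightarrow> h n t = g n (\<gamma> t)"
      by metis
    have h_fin: "(\<integral>\<^sup>+t\<in>{0..l}. h n t \<partial>lborel) < \<infinity>" for n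
    proof -
      have "(\<integral>\<^sup>+t\<in>{0..l}. h n t \<partial>lborel) = curve_integral (g n) \<gamma> l"
        by (rule curve_integral_eq[symmetric]) (rule hg)
      also have "\<dots> \<le> curve_integral (\<rho> n) \<gamma> l"
        by (intro curve_integral_mono \<rho>)
      finally show ?thesis using fin by (meson le_less_trans)
    qed
    have INF_distrib: "(INF n. h n t) * indicator {0..l} t = (INF n. h n t * indicator {0..l} t)" for t
      by (simp split: split_indicator)
    have "(\<integral>\<^sup>+t\<in>{0..l}. (INF n. h n t) \<partial>lborel) = (INF n. \<integral>\<^sup>+t\<in>{0..l}. h n t \<partial>lborel)"
      unfolding INF_distrib
    proof (rule nn_integral_monotone_convergence_INF_decseq)
      \<comment> \<open>The indicator matters: outside [0,l] the extensions \<open>h n\<close> are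
        unrelated for different \<open>n\<close>.\<close>
      show "decseq (\<lambda>n t. h n t * indicator {0..l} t)"
        by (intro decseq_SucI le_funI) (auto simp: hg dec split: split_indicator)
    qed (use h_fin in auto)
    also have "\<dots> = (INF n. curve_integral (g n) \<gamma> l)"
      by (intro INF_cong refl curve_integral_eq[symmetric] hg)
    finally have "curve_integral (\<lambda>x. INF n. g n x) \<gamma> l = (INF n. curve_integral (g n) \<gamma> l)"
      using curve_integral_eq[of l "\<lambda>t. INF n. h n t" "\<lambda>x. INF n. g n x" \<gamma>] hg by simp
    with ug show "ug_inequality f (\<lambda>x. INF n. g n x) \<gamma> l"
      by (auto simp: ug_inequality_def intro: INF_greatest)
  qed measurable
  then show ?thesis by (rule that)
qed

lemma upper_gradient_imp_borel_wug:
  assumes "upper_gradient f g" "(\<integral>\<^sup>+x. epowr (g x) p \<partial>M) < \<infinity>"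
  shows "borel_wug M p f g g"
  using assms by (auto simp: borel_wug_def upper_gradient_def)

text \<open>
  A minimizing sequence for \<open>\<integral> g\<^sup>p\<close> can be taken decreasing, because the minimum of two
  weak upper gradients is one.
\<close>

lemma exists_minimal_borel_wug:
  assumes M: "metric_measure_space M" and p: "0 < p" and g0: "borel_wug M p f g0 \<rho>0"
  obtains g \<rho> where "borel_wug M p f g \<rho>"
    "\<And>h \<sigma>. borel_wug M p f h \<sigma> \<Longrightarrow> (\<integral>\<^sup>+x. epowr (g x) p \<partial>M) \<le> (\<integral>\<^sup>+x. epowr (h x) p \<partial>M)"
proof -
  define \<I> where "\<I> g = (\<integral>\<^sup>+x. epowr (g x) p \<partial>M)" for g
  define W where "W = {g. \<exists>\<rho>. borel_wug M p f g \<rho>}"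
  have \<I>_mono: "\<I> g \<le> \<I> h" if "\<And>x. g x \<le> h x" for g h
    unfolding \<I>_def by (intro nn_integral_mono epowr_mono p that)
  have "\<I> ` W \<noteq> {}" using g0 by (auto simp: W_def)
  then obtain q where q: "range q \<subseteq> \<I> ` W" "Inf (\<I> ` W) = (INF i::nat. q i)"
    using ennreal_Inf_countable_INF[of "\<I> ` W"] by auto
  then have "\<exists>g. g \<in> W \<and> \<I> g = q n" for n
    by (metis image_iff rangeI subsetD)
  then have "\<exists>k. \<forall>n. k n \<in> W \<and> \<I> (k n) = q n"
    by (intro choice allI)
  then obtain k where k: "\<And>n. k n \<in> W" "\<And>n. \<I> (k n) = q n"
    by blast
  \<comment> \<open>Running minima: they stay in \<open>W\<close> by \<open>borel_wug_min\<close>,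
    and the energy of \<open>h n\<close> is at most \<open>q n\<close>.\<close>
  define h where "h = rec_nat (k 0) (\<lambda>n h x. min (h x) (k (Suc n) x))"
  have h_0: "h 0 = k 0" and h_Suc: "h (Suc n) = (\<lambda>x. min (h n x) (k (Suc n) x))" for n
    by (simp_all add: h_def)
  have h_le: "h n x \<le> k n x" for n x
    by (cases n) (auto simp: h_0 h_Suc)
  have "h n \<in> W" for n
  proof (induction n)
    case 0
    then show ?case using k by (simp add: h_0)
  next
    case (Suc n)
    then show ?case using k(1)[of "Suc n"] borel_wug_min[OF M] unfolding W_def h_Suc by blast
  qed
  then obtain \<rho> where \<rho>: "\<And>n. borel_wug M p f (h n) (\<rho> n)"
    unfolding W_def mem_Collect_eq by metis
  obtain \<sigma> where \<sigma>: "borel_wug M p f (\<lambda>x. INF n. h n x) \<sigma>"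
    using borel_wug_INF[OF M p, of f h \<rho>] \<rho> by (auto simp: h_Suc)
  show ?thesis
  proof
    fix g' \<sigma>' assume "borel_wug M p f g' \<sigma>'"
    have "\<I> (\<lambda>x. INF n. h n x) \<le> q n" for n
      unfolding k(2)[symmetric] by (intro \<I>_mono) (meson INF_lower2 UNIV_I h_le)
    then have "\<I> (\<lambda>x. INF n. h n x) \<le> (INF n. q n)"
      by (rule INF_greatest)
    also have "\<dots> \<le> \<I> g'"
      using \<open>borel_wug M p f g' \<sigma>'\<close> unfolding q(2)[symmetric] by (intro INF_lower) (auto simp: W_def)
    finally show "(\<integral>\<^sup>+x. epowr (INF n. h n x) p \<partial>M) \<le> (\<integral>\<^sup>+x. epowr (g' x) p \<partial>M)"
      by (simp add: \<I>_def)
  qed (fact \<sigma>)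
qed

text \<open>The difference of the \<open>p\<close>-th powers is nonnegative with integral 0, hence
  vanishes almost everywhere; finiteness of the smaller integral permits the subtraction.\<close>

lemma nn_integral_epowr_eq_imp_AE_eq:
  assumes p: "0 < p" and [measurable]: "g \<in> borel_measurable M" "m \<in> borel_measurable M"
    and le: "\<And>x. m x \<le> g x"
    and int: "(\<integral>\<^sup>+x. epowr (g x) p \<partial>M) \<le> (\<integral>\<^sup>+x. epowr (m x) p \<partial>M)" "(\<integral>\<^sup>+x. epowr (m x) p \<partial>M) < \<infinity>"
  shows "AE x in M. m x = g x"
proof -
  have le': "epowr (m x) p \<le> epowr (g x) p" for x
    by (intro epowr_mono p le)
  have "(\<integral>\<^sup>+x. epowr (g x) p - epowr (m x) p \<partial>M) = (\<integral>\<^sup>+x. epowr (g x) p \<partial>M) - (\<integral>\<^sup>+x. epowr (m x) p \<partial>M)"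
    using int le' by (intro nn_integral_diff) (auto simp: top_unique)
  also have "\<dots> = 0"
    using int le_less_trans[OF int] by (simp add: diff_eq_0_iff_ennreal)
  finally have "AE x in M. epowr (g x) p - epowr (m x) p = 0"
    by (subst (asm) nn_integral_0_iff_AE) auto
  moreover have "AE x in M. epowr (m x) p \<noteq> \<infinity>"
    using int by (intro nn_integral_noteq_infinite) auto
  ultimately show ?thesis
  proof eventually_elim
    case (elim x)
    then have "epowr (g x) p \<le> epowr (m x) p"
      by (auto simp: diff_eq_0_iff_ennreal)
    with le'[of x] show ?case
      using epowr_eq_iff[OF p, of "m x" "g x"] by simp
  qed
qed

text \<open>An energy minimizer is minimal almost everywhere: its minimum with a competitor is again
  admissible, so it cannot have less energy and must agree with the minimizer a.e. Existence is what
  gives the \<open>SOME\<close> in \<open>minimal_weak_ug\<close> its meaning.\<close>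

lemma is_minimal_weak_ug_minimal_weak_ug:
  assumes M: "metric_measure_space M" and p: "0 < p"
    and "upper_gradient f g0" "(\<integral>\<^sup>+x. epowr (g0 x) p \<partial>M) < \<infinity>"
  shows "is_minimal_weak_ug M p f (minimal_weak_ug M p f)"
proof -
  obtain g \<rho> where g: "borel_wug M p f g \<rho>"
    and min: "\<And>h \<sigma>. borel_wug M p f h \<sigma> \<Longrightarrow> (\<integral>\<^sup>+x. epowr (g x) p \<partial>M) \<le> (\<integral>\<^sup>+x. epowr (h x) p \<partial>M)"
    using exists_minimal_borel_wug[OF M p upper_gradient_imp_borel_wug[OF assms(3,4)]] by blast
  have meas: "g \<in> borel_measurable M"
    using g metric_measure_space_measurable(1)[OF M] by (auto simp: borel_wug_def)
  have "(\<integral>\<^sup>+x. epowr (g x) p \<partial>M) \<le> (\<integral>\<^sup>+x. epowr (\<rho> x) p \<partial>M)"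
    using g by (intro nn_integral_mono epowr_mono p) (auto simp: borel_wug_def)
  also have "\<dots> < \<infinity>"
    using g by (simp add: borel_wug_def)
  finally have fin: "(\<integral>\<^sup>+x. epowr (g x) p \<partial>M) < \<infinity>" .
  have "is_minimal_weak_ug M p f g"
    unfolding is_minimal_weak_ug_def
  proof (intro conjI allI impI)
    show "weak_upper_gradient M p f g"
      using borel_wug_imp_weak_upper_gradient[OF M g] .
    show "in_Lp M p g"
      using meas fin by (simp add: in_Lp_def)
    fix h assume "weak_upper_gradient M p f h \<and> in_Lp M p h"
    then obtain h' \<sigma> where h': "borel_wug M p f h' \<sigma>" "AE x in M. h' x = h x"
      using weak_upper_gradient_borel[OF M] by metis
    have h'_meas: "h' \<in> borel_measurable M"
      using h' metric_measure_space_measurable(1)[OF M] by (auto simp: borel_wug_def)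
    have "(\<integral>\<^sup>+x. epowr (min (g x) (h' x)) p \<partial>M) \<le> (\<integral>\<^sup>+x. epowr (g x) p \<partial>M)"
      by (intro nn_integral_mono epowr_mono p) auto
    with fin have "AE x in M. min (g x) (h' x) = g x"
      using meas h'_meas min[OF borel_wug_min[OF M g h'(1)]]
      by (intro nn_integral_epowr_eq_imp_AE_eq[OF p]) (auto intro: le_less_trans)
    with h'(2) show "AE x in M. g x \<le> h x"
      by eventually_elim (auto simp: min_def split: if_splits)
  qed
  then show ?thesis
    unfolding minimal_weak_ug_def using someI[of "is_minimal_weak_ug M p f" g] by simp
qed

section \<open>Newtonian functions and genuine upper gradients\<close>

lemma newtonian_space_upper_gradient:
  assumes p: "0 < p" and "u \<in> newtonian_space M p"
  obtains g where "upper_gradient u g" "(\<integral>\<^sup>+x. epowr (g x) p \<partial>M) < \<infinity>"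
proof -
  have "newtonian_norm M p u < \<infinity>"
    using assms by (simp add: newtonian_space_def)
  then have "(INF g\<in>{g. upper_gradient u g}. \<integral>\<^sup>+x. epowr (g x) p \<partial>M) < \<infinity>"
    unfolding newtonian_norm_def by (auto simp: less_top[symmetric])
  then show ?thesis
    using that by (auto simp: INF_less_iff)
qed

lemma newtonian_spaceI:
  assumes "u \<in> borel_measurable M" "(\<integral>\<^sup>+x. epowr (e2ennreal \<bar>u x\<bar>) p \<partial>M) < \<infinity>"
    "upper_gradient u g" "(\<integral>\<^sup>+x. epowr (g x) p \<partial>M) < \<infinity>"
  shows "u \<in> newtonian_space M p"
proof -
  have "(INF g\<in>{g. upper_gradient u g}. \<integral>\<^sup>+x. epowr (g x) p \<partial>M) \<le> (\<integral>\<^sup>+x. epowr (g x) p \<partial>M)"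
    using assms by (intro INF_lower) auto
  also note assms(4)
  finally have "(\<integral>\<^sup>+x. epowr (e2ennreal \<bar>u x\<bar>) p \<partial>M)
      + (INF g\<in>{g. upper_gradient u g}. \<integral>\<^sup>+x. epowr (g x) p \<partial>M) < \<infinity>"
    using assms(2) by simp
  then show ?thesis
    using assms(1) unfolding newtonian_space_def newtonian_norm_def
    by (simp add: less_top[symmetric])
qed

text \<open>Where \<open>g'\<close> fails, \<open>\<rho>\<close> and all its positive multiples have
  infinite integral, so a small multiple repairs every curve at small cost. A maximum is taken
  instead of a sum because its \<open>p\<close>-th power is bounded by the sum of the
  \<open>p\<close>-th powers without a constant.\<close>

lemma weak_upper_gradient_approx:
  fixes M :: "'a::metric_space measure"
  assumes M: "metric_measure_space M" and p: "0 < p"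
    and "weak_upper_gradient M p f g" "in_Lp M p g" and [measurable]: "S \<in> sets M" and e: "0 < e"
  obtains G where "upper_gradient f G"
    "(\<integral>\<^sup>+x\<in>S. epowr (G x) p \<partial>M) \<le> (\<integral>\<^sup>+x\<in>S. epowr (g x) p \<partial>M) + ennreal e"
proof -
  obtain g' \<rho> where g': "borel_wug M p f g' \<rho>" "AE x in M. g' x = g x"
    using weak_upper_gradient_borel[OF M assms(3,4)] by metis
  then have gb [measurable]: "g' \<in> borel_measurable borel" and \<rho>b [measurable]: "\<rho> \<in> borel_measurable borel"
    and \<rho>: "(\<integral>\<^sup>+x. epowr (\<rho> x) p \<partial>M) < \<infinity>"
    by (auto simp: borel_wug_def)
  have [measurable]: "g' \<in> borel_measurable M" "\<rho> \<in> borel_measurable M"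
    using gb \<rho>b by (auto intro: metric_measure_space_measurable(1)[OF M])
  define I where "I = enn2real (\<integral>\<^sup>+x. epowr (\<rho> x) p \<partial>M)"
  have I: "(\<integral>\<^sup>+x. epowr (\<rho> x) p \<partial>M) = ennreal I" "0 \<le> I"
    using \<rho> by (auto simp: I_def)
  \<comment> \<open>Chosen so that \<open>\<eta> powr p * I\<close> is at most \<open>e\<close>,
    also when \<open>I = 0\<close>.\<close>
  define \<eta> where "\<eta> = (e / (1 + I)) powr (1 / p)"
  have "0 < \<eta>" using e I by (simp add: \<eta>_def)
  have \<eta>: "\<eta> powr p = e / (1 + I)"
    using e I p by (simp add: \<eta>_def powr_powr)
  define G where "G x = max (g' x) (ennreal \<eta> * \<rho> x)" for x
  show ?thesis
  proof
    show "upper_gradient f G"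
      unfolding upper_gradient_def
    proof (intro conjI allI impI)
      show "G \<in> borel_measurable borel"
        unfolding G_def by measurable
      fix \<gamma> :: "real \<Rightarrow> 'a" and l assume \<gamma>: "is_curve \<gamma> l"
      show "ug_inequality f G \<gamma> l"
      proof (cases "curve_integral \<rho> \<gamma> l < \<infinity>")
        case True
        then have "ug_inequality f g' \<gamma> l"
          using g' \<gamma> by (auto simp: borel_wug_def)
        then show ?thesis
          by (rule ug_inequality_mono) (simp add: G_def)
      next
        case False
        have "ennreal \<eta> * curve_integral \<rho> \<gamma> l = curve_integral (\<lambda>x. ennreal \<eta> * \<rho> x) \<gamma> l"
          using \<gamma> \<rho>b by (simp add: curve_integral_cmult)
        also have "\<dots> \<le> curve_integral G \<gamma> l"
          by (intro curve_integral_mono) (simp add: G_def)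
        finally have "curve_integral G \<gamma> l = top"
          using False \<open>0 < \<eta>\<close> by (simp add: less_top[symmetric] ennreal_mult_top top_unique)
        then show ?thesis
          by (simp add: ug_inequality_def)
      qed
    qed
    have "(\<integral>\<^sup>+x\<in>S. epowr (G x) p \<partial>M)
        \<le> (\<integral>\<^sup>+x. epowr (g' x) p * indicator S x + ennreal (\<eta> powr p) * epowr (\<rho> x) p \<partial>M)"
    proof (intro nn_integral_mono)
      show "epowr (G x) p * indicator S x \<le> epowr (g' x) p * indicator S x + ennreal (\<eta> powr p) * epowr (\<rho> x) p" for x
        using epowr_max_le[of "g' x" "ennreal \<eta> * \<rho> x" p] \<open>0 < \<eta>\<close>
        by (simp add: G_def epowr_cmult split: split_indicator)
    qed
    also have "\<dots> = (\<integral>\<^sup>+x\<in>S. epowr (g' x) p \<partial>M) + ennreal (\<eta> powr p) * ennreal I"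
      by (simp add: nn_integral_add nn_integral_cmult I(1))
    also have "(\<integral>\<^sup>+x\<in>S. epowr (g' x) p \<partial>M) = (\<integral>\<^sup>+x\<in>S. epowr (g x) p \<partial>M)"
      by (intro nn_integral_cong_AE, use g'(2) in eventually_elim) simp
    also have "ennreal (\<eta> powr p) * ennreal I \<le> ennreal e"
      using e I(2) unfolding \<eta> by (auto simp: ennreal_mult[symmetric] field_simps intro!: ennreal_leI)
    finally show "(\<integral>\<^sup>+x\<in>S. epowr (G x) p \<partial>M) \<le> (\<integral>\<^sup>+x\<in>S. epowr (g x) p \<partial>M) + ennreal e"
      by (simp add: add_left_mono)
  qed
qed

section \<open>The upper bound\<close>

text \<open>\<open>s\<close> is the last time with value at most \<alpha>, and \<open>t\<close> the
  first time after \<open>s\<close> with value at least \<beta>; both exist by compactness.\<close>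

lemma continuous_crossing:
  fixes \<psi> :: "real \<Rightarrow> real"
  assumes \<psi>: "continuous_on {0..l} \<psi>" and "0 \<le> l" "\<psi> 0 \<le> \<alpha>" "\<beta> \<le> \<psi> l" "\<alpha> < \<beta>"
  obtains s t where "0 \<le> s" "s < t" "t \<le> l" "\<psi> s \<le> \<alpha>" "\<beta> \<le> \<psi> t"
    "\<And>\<tau>. s < \<tau> \<Longrightarrow> \<tau> < t \<Longrightarrow> \<alpha> < \<psi> \<tau> \<and> \<psi> \<tau> < \<beta>"
proof -
  have comp: "compact ({a..l} \<inter> \<psi> -` S)" if "closed S" "0 \<le> a" for S a
  proof -
    have "continuous_on {a..l} \<psi>"
      using \<psi> by (rule continuous_on_subset) (use that in auto)
    then have "closed ({a..l} \<inter> \<psi> -` S)"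
      using that by (intro continuous_closed_preimage) auto
    then show ?thesis
      by (auto simp: compact_eq_bounded_closed intro: bounded_subset[of "{a..l}"])
  qed
  have "\<exists>s\<in>{0..l} \<inter> \<psi> -` {..\<alpha>}. \<forall>t\<in>{0..l} \<inter> \<psi> -` {..\<alpha>}. t \<le> s"
    using assms by (intro compact_attains_sup comp) auto
  then obtain s where s: "0 \<le> s" "s \<le> l" "\<psi> s \<le> \<alpha>" "\<And>t. 0 \<le> t \<Longrightarrow> t \<le> l \<Longrightarrow> \<psi> t \<le> \<alpha> \<Longrightarrow> t \<le> s"
    by auto
  have "\<exists>t\<in>{s..l} \<inter> \<psi> -` {\<beta>..}. \<forall>\<tau>\<in>{s..l} \<inter> \<psi> -` {\<beta>..}. t \<le> \<tau>"
    using assms s by (intro compact_attains_inf comp) auto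
  then obtain t where t: "s \<le> t" "t \<le> l" "\<beta> \<le> \<psi> t" "\<And>\<tau>. s \<le> \<tau> \<Longrightarrow> \<tau> \<le> l \<Longrightarrow> \<beta> \<le> \<psi> \<tau> \<Longrightarrow> t \<le> \<tau>"
    by auto
  show ?thesis
  proof
    show "s < t"
      using s t \<open>\<alpha> < \<beta>\<close> by (cases "s = t") auto
    show "\<alpha> < \<psi> \<tau> \<and> \<psi> \<tau> < \<beta>" if "s < \<tau>" "\<tau> < t" for \<tau>
      using s(1) s(4)[of \<tau>] t(2) t(4)[of \<tau>] that by force
  qed (use s t in auto)
qed

text \<open>Strictly between the two crossing times the curve lies in the annulus. The distance to
  \<open>x0\<close> is 1-Lipschitz along an arc-length curve, so these times are at least \<beta> -
  \<alpha> apart.\<close>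

lemma annulus_crossing:
  fixes x0 :: "'a::metric_space"
  assumes \<gamma>: "is_curve \<gamma> l" and "r \<le> \<alpha>" "\<alpha> < \<beta>" "\<beta> \<le> R"
    and ends: "dist x0 (\<gamma> 0) \<le> \<alpha> \<and> \<beta> \<le> dist x0 (\<gamma> l) \<or> dist x0 (\<gamma> l) \<le> \<alpha> \<and> \<beta> \<le> dist x0 (\<gamma> 0)"
  shows "ennreal (\<beta> - \<alpha>) \<le> curve_integral (indicator (ball x0 R - ball x0 r)) \<gamma> l"
proof -
  let ?\<phi> = "\<lambda>t. dist x0 (\<gamma> t)"
  have "0 \<le> l"
    using \<gamma> by (simp add: is_curve_def)
  have cont: "continuous_on {0..l} ?\<phi>"
    by (intro continuous_on_dist continuous_on_const is_curve_continuous_on[OF \<gamma>])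
  obtain s t where st: "0 \<le> s" "s < t" "t \<le> l" "\<beta> - \<alpha> \<le> \<bar>?\<phi> t - ?\<phi> s\<bar>"
    "\<And>\<tau>. s < \<tau> \<Longrightarrow> \<tau> < t \<Longrightarrow> \<alpha> < ?\<phi> \<tau> \<and> ?\<phi> \<tau> < \<beta>"
    using ends
  proof
    assume "?\<phi> 0 \<le> \<alpha> \<and> \<beta> \<le> ?\<phi> l"
    with \<open>\<alpha> < \<beta>\<close> obtain s t where "0 \<le> s" "s < t" "t \<le> l" "?\<phi> s \<le> \<alpha>" "\<beta> \<le> ?\<phi> t"
      "\<And>\<tau>. s < \<tau> \<Longrightarrow> \<tau> < t \<Longrightarrow> \<alpha> < ?\<phi> \<tau> \<and> ?\<phi> \<tau> < \<beta>"
      using continuous_crossing[OF cont \<open>0 \<le> l\<close>, of \<alpha> \<beta>] by metis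
    then show ?thesis
      by (intro that[of s t]) auto
  next
    assume e: "?\<phi> l \<le> \<alpha> \<and> \<beta> \<le> ?\<phi> 0"
    \<comment> \<open>An inward crossing is an outward one for the negated distance.\<close>
    have "continuous_on {0..l} (\<lambda>t. - ?\<phi> t)"
      by (rule continuous_on_minus[OF cont])
    from continuous_crossing[OF this \<open>0 \<le> l\<close>, of "- \<beta>" "- \<alpha>"]
    obtain s t where st: "0 \<le> s" "s < t" "t \<le> l" "- ?\<phi> s \<le> - \<beta>" "- \<alpha> \<le> - ?\<phi> t"
      "\<And>\<tau>. s < \<tau> \<Longrightarrow> \<tau> < t \<Longrightarrow> - \<beta> < - ?\<phi> \<tau> \<and> - ?\<phi> \<tau> < - \<alpha>"
      using e \<open>\<alpha> < \<beta>\<close> by (metis neg_le_iff_le neg_less_iff_less)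
    then show ?thesis
      by (intro that[of s t]) force+
  qed
  have "\<bar>?\<phi> t - ?\<phi> s\<bar> \<le> t - s"
    using dist_triangle[of x0 "\<gamma> t" "\<gamma> s"] dist_triangle[of x0 "\<gamma> s" "\<gamma> t"]
      is_curve_dist_le[OF \<gamma>, of s t] st(1-3) by (simp add: dist_commute)
  with st have "ennreal (\<beta> - \<alpha>) \<le> ennreal (t - s)"
    by (intro ennreal_leI) linarith
  also have "\<dots> = (\<integral>\<^sup>+\<tau>. indicator {s<..<t} \<tau> \<partial>lborel)"
    using st by simp
  also have "\<dots> \<le> curve_integral (indicator (ball x0 R - ball x0 r)) \<gamma> l"
    unfolding curve_integral_def nn_integral_completion
  proof (rule nn_integral_mono)
    show "indicator {s<..<t} \<tau> \<le> indicator (ball x0 R - ball x0 r) (\<gamma> \<tau>) * (indicator {0..l} \<tau> :: ennreal)" for \<tau>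
      using st(1-3) st(5)[of \<tau>] assms(2,4) by (auto split: split_indicator)
  qed
  finally show ?thesis .
qed

definition radial_cutoff :: "'a::metric_space \<Rightarrow> real \<Rightarrow> real \<Rightarrow> 'a \<Rightarrow> real" where
  "radial_cutoff x0 r R x = (R - max r (min R (dist x0 x))) / (R - r)"

lemma upper_gradient_radial_cutoff:
  fixes x0 :: "'a::metric_space"
  assumes "r < R"
  shows "upper_gradient (\<lambda>x. ereal (radial_cutoff x0 r R x))
    (\<lambda>x. ennreal (1 / (R - r)) * indicator (ball x0 R - ball x0 r) x)"
  unfolding upper_gradient_def
proof (intro conjI allI impI)
  let ?A = "ball x0 R - ball x0 r" and ?c = "\<lambda>v. max r (min R v)"
  have [measurable]: "?A \<in> sets borel" by auto
  show "(\<lambda>x. ennreal (1 / (R - r)) * indicator ?A x) \<in> borel_measurable borel" by measurable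
  fix \<gamma> :: "real \<Rightarrow> 'a" and l assume \<gamma>: "is_curve \<gamma> l"
  let ?a = "dist x0 (\<gamma> 0)" and ?b = "dist x0 (\<gamma> l)"
  have le: "ennreal \<bar>?c ?a - ?c ?b\<bar> \<le> curve_integral (indicator ?A) \<gamma> l"
  proof -
    \<comment> \<open>If the clamped values differ, the smaller is at least the distance it comes
      from and the larger at most its own, so they can serve as the levels \<alpha> and
      \<beta>.\<close>
    consider "?c ?a = ?c ?b" | "?c ?a < ?c ?b" | "?c ?b < ?c ?a" by linarith
    then show ?thesis
    proof cases
      case 2
      then show ?thesis
        using annulus_crossing[OF \<gamma>, of r "?c ?a" "?c ?b" R x0] \<open>r < R\<close>
        by (auto simp: max_def min_def split: if_splits)
    next
      case 3
      then show ?thesis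
        using annulus_crossing[OF \<gamma>, of r "?c ?b" "?c ?a" R x0] \<open>r < R\<close>
        by (auto simp: max_def min_def split: if_splits)
    qed simp
  qed
  have "radial_cutoff x0 r R (\<gamma> 0) - radial_cutoff x0 r R (\<gamma> l) = (1 / (R - r)) * (?c ?b - ?c ?a)"
    by (simp add: radial_cutoff_def diff_divide_distrib)
  then have "endpoint_diff (ereal (radial_cutoff x0 r R (\<gamma> 0))) (ereal (radial_cutoff x0 r R (\<gamma> l)))
      = ennreal (1 / (R - r) * \<bar>?c ?a - ?c ?b\<bar>)"
    using \<open>r < R\<close> by (simp only: endpoint_diff_real abs_mult abs_minus_commute) simp
  also have "\<dots> = ennreal (1 / (R - r)) * ennreal \<bar>?c ?a - ?c ?b\<bar>"
    using \<open>r < R\<close> by (intro ennreal_mult) auto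
  also have "\<dots> \<le> ennreal (1 / (R - r)) * curve_integral (indicator ?A) \<gamma> l"
    by (intro mult_left_mono le) simp
  also have "\<dots> = curve_integral (\<lambda>x. ennreal (1 / (R - r)) * indicator ?A x) \<gamma> l"
    by (rule curve_integral_cmult[OF \<gamma>, symmetric]) measurable
  finally show "ug_inequality (\<lambda>x. ereal (radial_cutoff x0 r R x)) (\<lambda>x. ennreal (1 / (R - r)) * indicator ?A x) \<gamma> l"
    by (simp add: ug_inequality_def)
qed

lemma var_cap_annulus_le:
  fixes x0 :: "'a::metric_space"
  assumes M: "metric_measure_space M" and p: "0 < p" and r: "0 < R" "r < R"
  shows "var_cap M p (ball x0 r) (ball x0 R) \<le> emeasure M (ball x0 R - ball x0 r) / ennreal ((R - r) powr p)"
proof -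
  let ?A = "ball x0 R - ball x0 r"
  define u where "u x = ereal (radial_cutoff x0 r R x)" for x
  define g :: "'a \<Rightarrow> ennreal" where "g x = ennreal (1 / (R - r)) * indicator ?A x" for x
  have sets: "ball x0 R \<in> sets M" "?A \<in> sets M"
    using metric_measure_space_measurable(2)[OF M] by auto
  have g: "upper_gradient u g"
    unfolding u_def g_def using r by (intro upper_gradient_radial_cutoff)
  have cutoff: "0 \<le> radial_cutoff x0 r R x" "radial_cutoff x0 r R x \<le> 1"
    "x \<in> ball x0 r \<Longrightarrow> radial_cutoff x0 r R x = 1" "x \<notin> ball x0 R \<Longrightarrow> radial_cutoff x0 r R x = 0" for x
    using r by (auto simp: radial_cutoff_def field_simps max_def min_def)
  have ball_fin: "emeasure M (ball x0 R) < \<infinity>"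
    using M r by (auto simp: metric_measure_space_def)
  have int_g: "(\<integral>\<^sup>+x. epowr (g x) p \<partial>M) = emeasure M ?A / ennreal ((R - r) powr p)"
  proof -
    have "epowr (g x) p = ennreal ((1 / (R - r)) powr p) * indicator ?A x" for x
      using r by (simp add: g_def epowr_ennreal split: split_indicator)
    moreover have "ennreal ((1 / (R - r)) powr p) = inverse (ennreal ((R - r) powr p))"
      using r by (simp add: inverse_ennreal powr_divide inverse_eq_divide)
    ultimately show ?thesis
      using sets by (simp add: nn_integral_cmult_indicator divide_ennreal_def mult.commute)
  qed
  have "emeasure M ?A \<le> emeasure M (ball x0 R)"
    using sets by (intro emeasure_mono) auto
  with ball_fin have "emeasure M ?A < \<infinity>" by (rule le_less_trans[rotated])
  then have g_fin: "(\<integral>\<^sup>+x. epowr (g x) p \<partial>M) < \<infinity>"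
    unfolding int_g using r by (simp add: divide_ennreal_def ennreal_mult_less_top inverse_ennreal)
  have u_N: "u \<in> newtonian_space M p"
  proof (rule newtonian_spaceI[OF _ _ g g_fin])
    have "continuous_on UNIV (radial_cutoff x0 r R)"
      unfolding radial_cutoff_def using r by (intro continuous_intros) auto
    then have [measurable]: "radial_cutoff x0 r R \<in> borel_measurable borel"
      by (rule borel_measurable_continuous_onI)
    show "u \<in> borel_measurable M"
      unfolding u_def by (rule metric_measure_space_measurable(1)[OF M]) measurable
    have "(\<integral>\<^sup>+x. epowr (e2ennreal \<bar>u x\<bar>) p \<partial>M) \<le> (\<integral>\<^sup>+x. indicator (ball x0 R) x \<partial>M)"
    proof (rule nn_integral_mono)
      fix x
      show "epowr (e2ennreal \<bar>u x\<bar>) p \<le> indicator (ball x0 R) x"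
        using cutoff[of x] p
        by (cases "x \<in> ball x0 R") (auto simp: u_def epowr_ennreal powr_le1)
    qed
    also have "\<dots> < \<infinity>" using sets ball_fin by simp
    finally show "(\<integral>\<^sup>+x. epowr (e2ennreal \<bar>u x\<bar>) p \<partial>M) < \<infinity>" .
  qed
  have "var_cap M p (ball x0 r) (ball x0 R) \<le> (\<integral>\<^sup>+x\<in>ball x0 R. epowr (minimal_weak_ug M p u x) p \<partial>M)"
    unfolding var_cap_def
    using u_N cutoff by (intro INF_lower) (auto simp: u_def split: split_indicator)
  \<comment> \<open>Minimality enters here: \<open>g\<close> competes as a weak upper gradient, so
    its energy bounds the one in the capacity.\<close>
  also have "\<dots> \<le> (\<integral>\<^sup>+x. epowr (g x) p \<partial>M)"
  proof (rule nn_integral_mono_AE)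
    have "weak_upper_gradient M p u g"
      by (rule borel_wug_imp_weak_upper_gradient[OF M upper_gradient_imp_borel_wug[OF g g_fin]])
    moreover have "in_Lp M p g"
      using g g_fin metric_measure_space_measurable(1)[OF M] by (auto simp: in_Lp_def upper_gradient_def)
    ultimately have "AE x in M. minimal_weak_ug M p u x \<le> g x"
      using is_minimal_weak_ug_minimal_weak_ug[OF M p g g_fin] by (auto simp: is_minimal_weak_ug_def)
    then show "AE x in M. epowr (minimal_weak_ug M p u x) p * indicator (ball x0 R) x \<le> epowr (g x) p"
      by eventually_elim (auto intro: epowr_mono[OF p] split: split_indicator)
  qed
  finally show ?thesis
    unfolding int_g .
qed

section \<open>The lower bound\<close>

text \<open>A curve that leaves \<Omega> has a first and a last time outside, and \<open>u\<close>
  vanishes at both. The end values are therefore controlled by the pieces before the first and after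
  the last such time, whose interiors run in \<Omega>, where nothing was cut off.\<close>

lemma upper_gradient_restrict:
  fixes u :: "'a::metric_space \<Rightarrow> ereal"
  assumes ug: "upper_gradient u g" and "open \<Omega>" and u0: "\<And>x. x \<notin> \<Omega> \<Longrightarrow> u x = 0"
  shows "upper_gradient u (\<lambda>x. g x * indicator \<Omega> x)"
  unfolding upper_gradient_def
proof (intro conjI allI impI)
  have [measurable]: "g \<in> borel_measurable borel" "\<Omega> \<in> sets borel"
    using assms by (auto simp: upper_gradient_def)
  show meas: "(\<lambda>x. g x * indicator \<Omega> x) \<in> borel_measurable borel"
    by measurable
  fix \<gamma> :: "real \<Rightarrow> 'a" and l assume \<gamma>: "is_curve \<gamma> l"
  then have "0 < l" by (simp add: is_curve_def)
  obtain h where h: "h \<in> borel_measurable borel" "\<And>t. t \<in> {0..l} \<Longrightarrow> h t = g (\<gamma> t)"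
    by (rule curve_measurable[OF \<gamma>, of g]) auto
  obtain k where k [measurable]: "k \<in> borel_measurable borel"
    and k_eq: "\<And>t. t \<in> {0..l} \<Longrightarrow> k t = g (\<gamma> t) * indicator \<Omega> (\<gamma> t)"
    by (rule curve_measurable[OF \<gamma> meas]) auto
  \<comment> \<open>Only interior times must lie in \<Omega>, because the cutting points lie
    outside; two points are null for the integral.\<close>
  have inside: "endpoint_diff (u (\<gamma> s)) (u (\<gamma> t)) \<le> (\<integral>\<^sup>+\<tau>\<in>{s..t}. k \<tau> \<partial>lborel)"
    if st: "0 \<le> s" "s < t" "t \<le> l" and in_\<Omega>: "\<And>\<tau>. s < \<tau> \<Longrightarrow> \<tau> < t \<Longrightarrow> \<gamma> \<tau> \<in> \<Omega>" for s t
  proof -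
    have "ug_inequality u g (\<lambda>\<tau>. \<gamma> (s + \<tau>)) (t - s)"
      using ug is_curve_subcurve[OF \<gamma> st] by (simp add: upper_gradient_def)
    then have "endpoint_diff (u (\<gamma> s)) (u (\<gamma> t)) \<le> (\<integral>\<^sup>+\<tau>\<in>{s..t}. h \<tau> \<partial>lborel)"
      using curve_integral_subcurve[of l h g \<gamma> s t] h st by (simp add: ug_inequality_def)
    also have "\<dots> = (\<integral>\<^sup>+\<tau>\<in>{s..t}. k \<tau> \<partial>lborel)"
      using AE_lborel_singleton[of s] AE_lborel_singleton[of t]
    proof (intro nn_integral_cong_AE, eventually_elim)
      case (elim \<tau>)
      then show ?case
        using h(2)[of \<tau>] k_eq[of \<tau>] in_\<Omega>[of \<tau>] st by (cases "\<tau> \<in> {s..t}") auto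
    qed
    finally show ?thesis .
  qed
  define E where "E = {0..l} \<inter> \<gamma> -` (- \<Omega>)"
  have outside_E: "\<gamma> \<tau> \<in> \<Omega>" if "\<tau> \<in> {0..l}" "\<tau> \<notin> E" for \<tau>
    using that unfolding E_def by blast
  have "endpoint_diff (u (\<gamma> 0)) (u (\<gamma> l)) \<le> (\<integral>\<^sup>+\<tau>\<in>{0..l}. k \<tau> \<partial>lborel)"
  proof (cases "E = {}")
    case True
    then show ?thesis
      using \<open>0 < l\<close> by (intro inside outside_E) auto
  next
    case False
    have "closed E"
      unfolding E_def using is_curve_continuous_on[OF \<gamma>] \<open>open \<Omega>\<close>
      by (intro continuous_closed_preimage closed_atLeastAtMost closed_Compl)
    then have "compact E"
      by (auto simp: compact_eq_bounded_closed E_def intro: bounded_subset[of "{0..l}"])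
    obtain a where a: "a \<in> E" "\<And>t. t \<in> E \<Longrightarrow> a \<le> t"
      using compact_attains_inf[OF \<open>compact E\<close> False] by blast
    obtain b where b: "b \<in> E" "\<And>t. t \<in> E \<Longrightarrow> t \<le> b"
      using compact_attains_sup[OF \<open>compact E\<close> False] by blast
    have ab: "0 \<le> a" "a \<le> b" "b \<le> l" "u (\<gamma> a) = 0" "u (\<gamma> b) = 0"
      using a b u0 by (auto simp: E_def)
    have zero: "endpoint_diff 0 0 = 0"
      using endpoint_diff_real[of 0 0] by (simp add: zero_ereal_def)
    have left: "endpoint_diff (u (\<gamma> 0)) 0 \<le> (\<integral>\<^sup>+\<tau>\<in>{0..a}. k \<tau> \<partial>lborel)"
    proof (cases "a = 0")
      case False
      then have "endpoint_diff (u (\<gamma> 0)) (u (\<gamma> a)) \<le> (\<integral>\<^sup>+\<tau>\<in>{0..a}. k \<tau> \<partial>lborel)"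
        using a(2) ab by (intro inside outside_E) force+
      then show ?thesis using ab by simp
    qed (use ab zero in simp)
    have right: "endpoint_diff 0 (u (\<gamma> l)) \<le> (\<integral>\<^sup>+\<tau>\<in>{b..l}. k \<tau> \<partial>lborel)"
    proof (cases "b = l")
      case False
      then have "endpoint_diff (u (\<gamma> b)) (u (\<gamma> l)) \<le> (\<integral>\<^sup>+\<tau>\<in>{b..l}. k \<tau> \<partial>lborel)"
        using b(2) ab by (intro inside outside_E) force+
      then show ?thesis using ab by simp
    qed (use ab zero in simp)
    have "endpoint_diff (u (\<gamma> 0)) (u (\<gamma> l)) \<le> endpoint_diff (u (\<gamma> 0)) 0 + endpoint_diff 0 (u (\<gamma> l))"
      by (rule endpoint_diff_triangle)
    also have "\<dots> \<le> (\<integral>\<^sup>+\<tau>\<in>{0..a}. k \<tau> \<partial>lborel) + (\<integral>\<^sup>+\<tau>\<in>{b..l}. k \<tau> \<partial>lborel)"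
      by (rule add_mono[OF left right])
    \<comment> \<open>The piece from \<open>a\<close> to \<open>b\<close> contributes nothing to the
      difference and is simply added to the integral.\<close>
    also have "\<dots> \<le> (\<integral>\<^sup>+\<tau>\<in>{0..a}. k \<tau> \<partial>lborel) + (\<integral>\<^sup>+\<tau>\<in>{a..l}. k \<tau> \<partial>lborel)"
      using ab by (intro add_left_mono nn_integral_mono) (auto split: split_indicator)
    also have "\<dots> = (\<integral>\<^sup>+\<tau>\<in>{0..l}. k \<tau> \<partial>lborel)"
      using ab by (intro set_nn_integral_lborel_combine) auto
    finally show ?thesis .
  qed
  also have "\<dots> = curve_integral (\<lambda>x. g x * indicator \<Omega> x) \<gamma> l"
    by (rule curve_integral_eq[symmetric]) (rule k_eq)
  finally show "ug_inequality u (\<lambda>x. g x * indicator \<Omega> x) \<gamma> l"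
    by (simp add: ug_inequality_def)
qed

section \<open>Packing in doubling measures\<close>

lemma metric_measure_space_ball:
  assumes M: "metric_measure_space M" and "0 < r"
  shows "emeasure M (ball x r) = ennreal (measure M (ball x r))" "0 < measure M (ball x r)"
    "ball x r \<in> fmeasurable M"
proof -
  have *: "0 < emeasure M (ball x r)" "emeasure M (ball x r) < \<infinity>"
    using assms by (auto simp: metric_measure_space_def)
  then show 1: "emeasure M (ball x r) = ennreal (measure M (ball x r))"
    by (intro emeasure_eq_ennreal_measure) auto
  show "0 < measure M (ball x r)"
    using * unfolding 1 by simp
  show "ball x r \<in> fmeasurable M"
    using * metric_measure_space_measurable(2)[OF M] by (intro fmeasurableI) auto
qed

lemma globally_doubling_measure:
  assumes M: "metric_measure_space M" and "globally_doubling M"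
  obtains D where "0 < D" "\<And>x r. 0 < r \<Longrightarrow> measure M (ball x (2 * r)) \<le> D * measure M (ball x r)"
proof -
  obtain D where D: "0 < D" "\<And>x r. 0 < r \<Longrightarrow> emeasure M (ball x (2 * r)) \<le> ennreal D * emeasure M (ball x r)"
    using assms(2) unfolding globally_doubling_def by auto
  show ?thesis
  proof
    fix x :: 'a and r :: real assume "0 < r"
    then have "ennreal (measure M (ball x (2 * r))) \<le> ennreal (D * measure M (ball x r))"
      using D(2)[of r x] metric_measure_space_ball(1)[OF M, of r x]
        metric_measure_space_ball(1)[OF M, of "2 * r" x] D(1)
      by (simp add: ennreal_mult)
    then show "measure M (ball x (2 * r)) \<le> D * measure M (ball x r)"
      using D(1) by (simp add: ennreal_le_iff)
  qed (fact D(1))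
qed

lemma doubling_ball_le:
  assumes M: "metric_measure_space M"
    and D: "0 < D" "\<And>x r. 0 < r \<Longrightarrow> measure M (ball x (2 * r)) \<le> D * measure M (ball x r)"
    and "0 < r" "ball y \<rho> \<subseteq> ball x (2 ^ k * r)"
  shows "measure M (ball y \<rho>) \<le> D ^ k * measure M (ball x r)"
proof -
  have "measure M (ball x (2 ^ k * r)) \<le> D ^ k * measure M (ball x r)"
  proof (induction k)
    case (Suc k)
    have "measure M (ball x (2 ^ Suc k * r)) \<le> D * measure M (ball x (2 ^ k * r))"
      using D(2)[of "2 ^ k * r" x] \<open>0 < r\<close> by (simp add: mult.assoc)
    also have "\<dots> \<le> D * (D ^ k * measure M (ball x r))"
      using Suc D(1) by (intro mult_left_mono) auto
    finally show ?case by (simp add: mult.assoc)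
  qed simp
  moreover have "measure M (ball y \<rho>) \<le> measure M (ball x (2 ^ k * r))"
    using assms metric_measure_space_measurable(2)[OF M]
    by (intro measure_mono_fmeasurable metric_measure_space_ball(3)[OF M]) auto
  ultimately show ?thesis by simp
qed

text \<open>The balls of radius \<open>s / 2\<close> around the points are disjoint and lie in one
  ball of mass \<open>W\<close>, while each of them carries at least the fraction
  \<open>1 / D ^ k\<close> of \<open>W\<close>.\<close>

lemma doubling_separated_card_le:
  fixes M :: "'a::metric_space measure" and y :: 'a
  assumes M: "metric_measure_space M"
    and D: "0 < D" "\<And>x r. 0 < r \<Longrightarrow> measure M (ball x (2 * r)) \<le> D * measure M (ball x r)"
    and T: "finite T" "T \<subseteq> ball y \<rho>" and "0 < s"
    and sep: "pairwise (\<lambda>a b. s \<le> dist a b) T"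
    and k: "4 * \<rho> / s + 1 \<le> 2 ^ k"
  shows "real (card T) \<le> D ^ k"
proof (cases "T = {}")
  case False
  then obtain a where "a \<in> T" by auto
  then have "dist y a < \<rho>" using T by auto
  then have "0 < \<rho>" by (meson le_less_trans zero_le_dist)
  define W where "W = measure M (ball y (\<rho> + s / 2))"
  have "0 < W"
    unfolding W_def using \<open>0 < \<rho>\<close> \<open>0 < s\<close> by (intro metric_measure_space_ball(2)[OF M]) simp
  have W_le: "W \<le> D ^ k * measure M (ball x (s / 2))" if "x \<in> T" for x
    unfolding W_def
  proof (rule doubling_ball_le[OF M D])
    show "ball y (\<rho> + s / 2) \<subseteq> ball x (2 ^ k * (s / 2))"
    proof
      fix z assume "z \<in> ball y (\<rho> + s / 2)"
      then have "dist x z < 2 * \<rho> + s / 2"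
        using dist_triangle[of x z y] that T(2) by (auto simp: dist_commute)
      \<comment> \<open>Origin of the hypothesis on \<open>k\<close>: the required radius in units
        of \<open>s / 2\<close>.\<close>
      also have "2 * \<rho> + s / 2 = (4 * \<rho> / s + 1) * (s / 2)"
        using \<open>0 < s\<close> by (simp add: field_simps)
      also have "\<dots> \<le> 2 ^ k * (s / 2)"
        using k \<open>0 < s\<close> by (intro mult_right_mono) auto
      finally show "z \<in> ball x (2 ^ k * (s / 2))" by simp
    qed
  qed (use \<open>0 < s\<close> in auto)
  have "disjoint_family_on (\<lambda>x. ball x (s / 2)) T"
    unfolding disjoint_family_on_def
  proof (intro ballI impI, rule ccontr)
    fix a b assume "a \<in> T" "b \<in> T" "a \<noteq> b" "ball a (s / 2) \<inter> ball b (s / 2) \<noteq> {}"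
    then obtain z where "dist a z < s / 2" "dist b z < s / 2" by auto
    then have "dist a b < s"
      using dist_triangle2[of a b z] by simp
    with pairwiseD[OF sep \<open>a \<in> T\<close> \<open>b \<in> T\<close> \<open>a \<noteq> b\<close>] show False by simp
  qed
  then have "(\<Sum>x\<in>T. measure M (ball x (s / 2))) = measure M (\<Union>x\<in>T. ball x (s / 2))"
    using T(1) metric_measure_space_measurable(2)[OF M] metric_measure_space_ball(1)[OF M] \<open>0 < s\<close>
    by (intro measure_finite_Union[symmetric]) auto
  also have "\<dots> \<le> W"
    unfolding W_def
  proof (rule measure_mono_fmeasurable)
    show "(\<Union>x\<in>T. ball x (s / 2)) \<subseteq> ball y (\<rho> + s / 2)"
    proof clarify
      fix x z assume "x \<in> T" "z \<in> ball x (s / 2)"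
      moreover from this have "dist y x < \<rho>" using T(2) by auto
      ultimately show "z \<in> ball y (\<rho> + s / 2)"
        using dist_triangle[of y z x] by simp
    qed
    show "(\<Union>x\<in>T. ball x (s / 2)) \<in> sets M"
      by (intro metric_measure_space_measurable(2)[OF M] borel_open open_UN) auto
    show "ball y (\<rho> + s / 2) \<in> fmeasurable M"
      using \<open>0 < \<rho>\<close> \<open>0 < s\<close> by (intro metric_measure_space_ball(3)[OF M]) simp
  qed
  finally have sum_le: "(\<Sum>x\<in>T. measure M (ball x (s / 2))) \<le> W" .
  have "real (card T) * W = (\<Sum>x\<in>T. W)" by simp
  also have "\<dots> \<le> (\<Sum>x\<in>T. D ^ k * measure M (ball x (s / 2)))"
    by (intro sum_mono W_le)
  also have "\<dots> \<le> D ^ k * W"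
    using sum_le D(1) by (simp add: sum_distrib_left[symmetric])
  finally show ?thesis
    using \<open>0 < W\<close> by simp
qed (use D in simp)

text \<open>A separated set of largest cardinality covers, because an uncovered point could be added
  to it. The bound \<open>N\<close> makes a largest cardinality exist.\<close>

lemma separated_cover:
  fixes A :: "'a::metric_space set"
  assumes "0 < s"
    and bound: "\<And>T. finite T \<Longrightarrow> T \<subseteq> A \<Longrightarrow> pairwise (\<lambda>a b. s \<le> dist a b) T \<Longrightarrow> real (card T) \<le> N"
  obtains T where "finite T" "T \<subseteq> A" "pairwise (\<lambda>a b. s \<le> dist a b) T" "A \<subseteq> (\<Union>x\<in>T. ball x s)"
proof -
  define P where "P T \<longleftrightarrow> finite T \<and> T \<subseteq> A \<and> pairwise (\<lambda>a b. s \<le> dist a b) T" for T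
  have "card T < Suc (nat \<lceil>N\<rceil>)" if "P T" for T
  proof -
    have "real (card T) \<le> N"
      using that by (intro bound) (auto simp: P_def)
    then show ?thesis by linarith
  qed
  moreover have "P {}" by (simp add: P_def)
  ultimately obtain T where "P T" and max: "\<And>U. P U \<Longrightarrow> card U \<le> card T"
    using ex_has_greatest_nat[of P "{}" card "Suc (nat \<lceil>N\<rceil>)"] by (metis less_imp_le)
  have "z \<in> (\<Union>x\<in>T. ball x s)" if "z \<in> A" for z
  proof (rule ccontr)
    assume "z \<notin> (\<Union>x\<in>T. ball x s)"
    then have far: "\<And>x. x \<in> T \<Longrightarrow> s \<le> dist x z"
      by (auto simp: not_less)
    with \<open>0 < s\<close> have "z \<notin> T" by fastforce
    have "P (insert z T)"
      using \<open>P T\<close> \<open>z \<in> A\<close> far by (auto simp: P_def dist_commute pairwise_insert)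
    then have "card (insert z T) \<le> card T" by (rule max)
    with \<open>z \<notin> T\<close> \<open>P T\<close> show False by (simp add: P_def)
  qed
  with \<open>P T\<close> show ?thesis
    by (intro that[of T]) (auto simp: P_def)
qed

section \<open>From oscillation on one ball to the measure of the annulus\<close>

text \<open>Since |1 - c| + |c| is at least 1, no constant is close to both values of
  \<open>u\<close>. In the application \<open>c\<close> is the mean, about which nothing has to be
  known.\<close>

lemma oscillation_lower_bound:
  fixes u :: "'a \<Rightarrow> ereal" and c :: real
  assumes [measurable]: "B' \<in> sets M" "B'' \<in> sets M"
    and sub: "B' \<subseteq> B" "B'' \<subseteq> B" "B' \<inter> B'' = {}"
    and u: "\<And>y. y \<in> B' \<Longrightarrow> u y = 1" "\<And>y. y \<in> B'' \<Longrightarrow> u y = 0"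
    and m: "ennreal m \<le> emeasure M B'" "ennreal m \<le> emeasure M B''" and "0 \<le> m"
  shows "ennreal m \<le> (\<integral>\<^sup>+y\<in>B. e2ennreal \<bar>u y - ereal c\<bar> \<partial>M)"
proof -
  have "ennreal m \<le> ennreal (\<bar>1 - c\<bar> * m + \<bar>c\<bar> * m)"
  proof (rule ennreal_leI)
    have "1 * m \<le> (\<bar>1 - c\<bar> + \<bar>c\<bar>) * m"
      using \<open>0 \<le> m\<close> by (intro mult_right_mono) linarith+
    then show "m \<le> \<bar>1 - c\<bar> * m + \<bar>c\<bar> * m"
      by (simp add: distrib_right)
  qed
  also have "\<dots> = ennreal \<bar>1 - c\<bar> * ennreal m + ennreal \<bar>c\<bar> * ennreal m"
    using \<open>0 \<le> m\<close> by (simp add: ennreal_mult)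
  also have "\<dots> \<le> ennreal \<bar>1 - c\<bar> * emeasure M B' + ennreal \<bar>c\<bar> * emeasure M B''"
    using m by (intro add_mono mult_left_mono) auto
  also have "\<dots> = (\<integral>\<^sup>+y. ennreal \<bar>1 - c\<bar> * indicator B' y + ennreal \<bar>c\<bar> * indicator B'' y \<partial>M)"
    by (simp add: nn_integral_add nn_integral_cmult)
  also have "\<dots> \<le> (\<integral>\<^sup>+y\<in>B. e2ennreal \<bar>u y - ereal c\<bar> \<partial>M)"
  proof (rule nn_integral_mono)
    show "ennreal \<bar>1 - c\<bar> * indicator B' y + ennreal \<bar>c\<bar> * indicator B'' y
        \<le> e2ennreal \<bar>u y - ereal c\<bar> * indicator B y" for y
      using sub u[of y] by (auto simp: one_ereal_def zero_ereal_def split: split_indicator)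
  qed
  finally show ?thesis .
qed

text \<open>The Poincare inequality solved for the measure: \<open>1 / \<kappa>\<close> bounds the
  mean oscillation from below, \<open>I\<close> is the energy and \<open>m\<close> the measure of
  the enlarged ball.\<close>

lemma le_of_epowr_average:
  assumes "0 < p" "0 < \<kappa>" "0 < b" "0 < m"
    and le: "ennreal (1 / \<kappa>) \<le> ennreal b * epowr (I / ennreal m) (1 / p)"
  shows "ennreal m \<le> ennreal ((\<kappa> * b) powr p) * I"
proof (cases I)
  case (real i)
  have "ennreal (1 / \<kappa>) \<le> ennreal (b * (i / m) powr (1 / p))"
    using le real assms by (simp add: divide_ennreal epowr_ennreal ennreal_mult)
  then have "1 / \<kappa> \<le> b * (i / m) powr (1 / p)"
    using assms by (subst (asm) ennreal_le_iff) auto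
  then have "1 \<le> (\<kappa> * b) * (i / m) powr (1 / p)"
    using assms by (simp add: field_simps)
  then have "1 powr p \<le> ((\<kappa> * b) * (i / m) powr (1 / p)) powr p"
    using assms by (intro powr_mono2) auto
  also have "\<dots> = (\<kappa> * b) powr p * (i / m)"
    using assms real by (simp add: powr_mult powr_powr)
  finally have "m \<le> (\<kappa> * b) powr p * i"
    using assms by (simp add: field_simps)
  then have "ennreal m \<le> ennreal ((\<kappa> * b) powr p * i)"
    by (rule ennreal_leI)
  with real show ?thesis
    by (simp add: ennreal_mult)
next
  case top
  then show ?thesis
    using assms by (simp add: ennreal_mult_top)
qed

text \<open>\<open>k\<close> doublings lead from radius a\<delta> to at least 4\<delta>, and
  \<open>j\<close> is the exponent of the packing bound for radius 2\<Lambda>\<delta> and separation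
  2\<delta>. Neither depends on \<open>r\<close> or \<open>R\<close>, which enter the factor only
  through \<open>\<delta> powr p\<close>.\<close>

lemma measure_annulus_le:
  fixes M :: "'a::metric_space measure" and x0 :: 'a and u :: "'a \<Rightarrow> ereal"
  assumes M: "metric_measure_space M" and p: "0 < p"
    and D: "0 < D" "\<And>x r. 0 < r \<Longrightarrow> measure M (ball x (2 * r)) \<le> D * measure M (ball x r)"
    and C: "0 < C" "1 \<le> \<Lambda>"
    and poincare: "\<And>x r f g. 0 < r \<and> f \<in> borel_measurable M \<and> (\<integral>\<^sup>+y. e2ennreal \<bar>f y\<bar> \<partial>M) < \<infinity> \<and> upper_gradient f g \<Longrightarrow>
        (\<integral>\<^sup>+y\<in>ball x r. e2ennreal \<bar>f y - ereal (ball_average M f x r)\<bar> \<partial>M) / emeasure M (ball x r)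
          \<le> ennreal (C * r) * epowr ((\<integral>\<^sup>+y\<in>ball x (\<Lambda> * r). epowr (g y) p \<partial>M)
                      / emeasure M (ball x (\<Lambda> * r))) (1 / p)"
    and a: "0 < a" and k: "4 / a \<le> 2 ^ k" and j: "4 * \<Lambda> + 1 \<le> 2 ^ j"
    and \<delta>: "0 < \<delta>" "R - r = \<delta>" and "0 < R"
    and balls: "\<And>x. x \<in> ball x0 R - ball x0 r \<Longrightarrow> \<exists>x' x''.
        ball x' (a * \<delta>) \<subseteq> ball x (2 * \<delta>) \<inter> ball x0 r \<and> ball x'' (a * \<delta>) \<subseteq> ball x (2 * \<delta>) - ball x0 R"
    and u: "u \<in> borel_measurable M" "\<And>x. x \<in> ball x0 R \<Longrightarrow> indicator (ball x0 r) x \<le> u x \<and> u x \<le> 1"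
      "\<And>x. x \<notin> ball x0 R \<Longrightarrow> u x = 0"
    and g: "upper_gradient u g"
  shows "emeasure M (ball x0 R - ball x0 r)
    \<le> ennreal ((D ^ k * (C * (2 * \<delta>))) powr p * D ^ j) * (\<integral>\<^sup>+x\<in>ball x0 R. epowr (g x) p \<partial>M)"
proof -
  let ?A = "ball x0 R - ball x0 r"
  define c where "c = (D ^ k * (C * (2 * \<delta>))) powr p"
  \<comment> \<open>Enlarged balls may stick out of the ball of radius \<open>R\<close>; with
    \<open>h\<close> in place of \<open>g\<close> their integrals collect only energy from
    inside.\<close>
  define h where "h x = g x * indicator (ball x0 R) x" for x
  have h: "upper_gradient u h"
    unfolding h_def by (rule upper_gradient_restrict[OF g _ u(3)]) auto
  have [measurable]: "h \<in> borel_measurable M"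
    using h metric_measure_space_measurable(1)[OF M] by (auto simp: upper_gradient_def)
  have [measurable]: "ball x r \<in> sets M" for x r
    by (rule metric_measure_space_measurable(2)[OF M]) auto
  have h_p: "epowr (h x) p = epowr (g x) p * indicator (ball x0 R) x" for x
    by (simp add: h_def split: split_indicator)
  have int_u: "(\<integral>\<^sup>+y. e2ennreal \<bar>u y\<bar> \<partial>M) < \<infinity>"
  proof -
    have "e2ennreal \<bar>u y\<bar> \<le> indicator (ball x0 R) y" for y
    proof (cases "y \<in> ball x0 R")
      case True
      have "0 \<le> (indicator (ball x0 r) y :: ereal)" by (simp split: split_indicator)
      also have "\<dots> \<le> u y" using u(2)[OF True] by simp
      finally have "e2ennreal \<bar>u y\<bar> \<le> e2ennreal 1"
        using u(2)[OF True] by (intro e2ennreal_mono) simp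
      also have "e2ennreal 1 = 1" by (simp add: one_ereal_def)
      finally show ?thesis using True by simp
    qed (use u(3) in \<open>simp add: zero_ereal_def\<close>)
    then have "(\<integral>\<^sup>+y. e2ennreal \<bar>u y\<bar> \<partial>M) \<le> (\<integral>\<^sup>+y. indicator (ball x0 R) y \<partial>M)"
      by (intro nn_integral_mono)
    also have "\<dots> < \<infinity>"
      using metric_measure_space_ball(1)[OF M \<open>0 < R\<close>, of x0] by simp
    finally show ?thesis .
  qed
  have local: "emeasure M (ball x (2 * \<delta>)) \<le> ennreal c * (\<integral>\<^sup>+y\<in>ball x (\<Lambda> * (2 * \<delta>)). epowr (h y) p \<partial>M)"
    if x: "x \<in> ?A" for x
  proof -
    obtain x' x'' where x': "ball x' (a * \<delta>) \<subseteq> ball x (2 * \<delta>) \<inter> ball x0 r"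
      and x'': "ball x'' (a * \<delta>) \<subseteq> ball x (2 * \<delta>) - ball x0 R"
      using balls[OF x] by blast
    have "0 < a * \<delta>" using a \<delta> by simp
    define m where "m = measure M (ball x (2 * \<delta>))"
    have "0 < m" and m: "emeasure M (ball x (2 * \<delta>)) = ennreal m"
      unfolding m_def using \<delta> metric_measure_space_ball[OF M, of "2 * \<delta>" x] by auto
    \<comment> \<open>As \<open>z\<close> lies in the ball around \<open>x\<close>, the latter is
      contained in the ball of radius 4\<delta> around \<open>z\<close>, which \<open>k\<close>
      doublings of a\<delta> reach.\<close>
    have mass: "ennreal (m / D ^ k) \<le> emeasure M (ball z (a * \<delta>))" if z: "ball z (a * \<delta>) \<subseteq> ball x (2 * \<delta>)" for z
    proof -
      have "z \<in> ball x (2 * \<delta>)" using z \<open>0 < a * \<delta>\<close> by (meson centre_in_ball subsetD)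
      have "m \<le> D ^ k * measure M (ball z (a * \<delta>))"
        unfolding m_def
      proof (rule doubling_ball_le[OF M D])
        have "4 * \<delta> = (4 / a) * (a * \<delta>)" using a by simp
        also have "\<dots> \<le> 2 ^ k * (a * \<delta>)"
          using k \<open>0 < a * \<delta>\<close> by (intro mult_right_mono) auto
        finally have "4 * \<delta> \<le> 2 ^ k * (a * \<delta>)" .
        moreover have "dist z y < 4 * \<delta>" if "y \<in> ball x (2 * \<delta>)" for y
          using that \<open>z \<in> ball x (2 * \<delta>)\<close> dist_triangle[of z y x] by (simp add: dist_commute)
        ultimately show "ball x (2 * \<delta>) \<subseteq> ball z (2 ^ k * (a * \<delta>))"
          by (force intro: less_le_trans)
      qed (use \<open>0 < a * \<delta>\<close> in auto)
      then show ?thesis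
        using D(1) metric_measure_space_ball(1)[OF M \<open>0 < a * \<delta>\<close>, of z]
        by (auto simp: field_simps intro!: ennreal_leI)
    qed
    have sub: "ball x' (a * \<delta>) \<subseteq> ball x (2 * \<delta>)" "ball x'' (a * \<delta>) \<subseteq> ball x (2 * \<delta>)"
      using x' x'' by blast+
    have "ennreal (m / D ^ k) \<le> (\<integral>\<^sup>+y\<in>ball x (2 * \<delta>). e2ennreal \<bar>u y - ereal (ball_average M u x (2 * \<delta>))\<bar> \<partial>M)"
    proof (rule oscillation_lower_bound)
      show "u y = 1" if "y \<in> ball x' (a * \<delta>)" for y
      proof -
        have "y \<in> ball x0 r" using that x' by blast
        moreover from this have "y \<in> ball x0 R" using \<delta> by simp
        ultimately show ?thesis using u(2)[of y] by (simp add: antisym)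
      qed
      show "u y = 0" if "y \<in> ball x'' (a * \<delta>)" for y
        using that x'' u(3) by blast
      show "ball x' (a * \<delta>) \<inter> ball x'' (a * \<delta>) = {}"
      proof -
        have "ball x0 r \<subseteq> ball x0 R" using \<delta> by (intro subset_ball) simp
        then show ?thesis using x' x'' by blast
      qed
    qed (use sub mass[OF sub(1)] mass[OF sub(2)] \<open>0 < m\<close> D(1) in auto)
    then have "ennreal (m / D ^ k) / ennreal m
      \<le> (\<integral>\<^sup>+y\<in>ball x (2 * \<delta>). e2ennreal \<bar>u y - ereal (ball_average M u x (2 * \<delta>))\<bar> \<partial>M) / ennreal m"
      by (rule divide_right_mono_ennreal)
    also have "\<dots> \<le> ennreal (C * (2 * \<delta>)) * epowr ((\<integral>\<^sup>+y\<in>ball x (\<Lambda> * (2 * \<delta>)). epowr (h y) p \<partial>M)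
                      / emeasure M (ball x (\<Lambda> * (2 * \<delta>)))) (1 / p)"
      unfolding m[symmetric] using \<delta> u(1) int_u h by (intro poincare) auto
    also have "ennreal (m / D ^ k) / ennreal m = ennreal (1 / D ^ k)"
      using \<open>0 < m\<close> D(1) by (simp add: divide_ennreal)
    finally have *: "ennreal (1 / D ^ k) \<le> ennreal (C * (2 * \<delta>)) *
        epowr ((\<integral>\<^sup>+y\<in>ball x (\<Lambda> * (2 * \<delta>)). epowr (h y) p \<partial>M) / emeasure M (ball x (\<Lambda> * (2 * \<delta>)))) (1 / p)" .
    have "0 < \<Lambda> * (2 * \<delta>)" using C(2) \<delta> by simp
    note big = metric_measure_space_ball[OF M this, of x]
    \<comment> \<open>The Poincare inequality bounds the measure of the enlarged ball, which is the
      larger one because \<Lambda> \<ge> 1.\<close>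
    have "emeasure M (ball x (2 * \<delta>)) \<le> emeasure M (ball x (\<Lambda> * (2 * \<delta>)))"
      using C(2) \<delta> by (intro emeasure_mono subset_ball) auto
    also have "\<dots> \<le> ennreal c * (\<integral>\<^sup>+y\<in>ball x (\<Lambda> * (2 * \<delta>)). epowr (h y) p \<partial>M)"
      using * p D(1) C(1) \<delta> big(2) unfolding big(1) c_def by (intro le_of_epowr_average) auto
    finally show ?thesis .
  qed
  \<comment> \<open>\<open>i\<close> depends on \<open>R / \<delta>\<close>, but it only secures a
    maximal separated set and does not enter the conclusion.\<close>
  have "\<exists>i. 4 * R / (2 * \<delta>) + 1 \<le> 2 ^ i"
    using real_arch_pow[of 2 "4 * R / (2 * \<delta>) + 1"] by (auto intro: less_imp_le)
  then obtain i where i: "4 * R / (2 * \<delta>) + 1 \<le> 2 ^ i" by blast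
  have "0 < 2 * \<delta>" using \<delta> by simp
  have card_le: "real (card T) \<le> D ^ i"
    if "finite T" "T \<subseteq> ?A" "pairwise (\<lambda>x y. 2 * \<delta> \<le> dist x y) T" for T
    using that i \<open>0 < 2 * \<delta>\<close>
    by (intro doubling_separated_card_le[OF M D, where s = "2 * \<delta>" and y = x0 and \<rho> = R]) auto
  obtain T where T: "finite T" "T \<subseteq> ?A" and sep: "pairwise (\<lambda>x y. 2 * \<delta> \<le> dist x y) T"
    and cover: "?A \<subseteq> (\<Union>x\<in>T. ball x (2 * \<delta>))"
    by (rule separated_cover[OF \<open>0 < 2 * \<delta>\<close> card_le])
  \<comment> \<open>The centres whose enlarged balls contain \<open>y\<close> lie in a ball around
    \<open>y\<close> and are 2\<delta>-separated, so the packing bound limits their number uniformly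
    in \<open>y\<close>.\<close>
  have overlap: "(\<Sum>x\<in>T. indicator (ball x (\<Lambda> * (2 * \<delta>))) y) \<le> ennreal (D ^ j)" for y
  proof -
    let ?S = "{x \<in> T. y \<in> ball x (\<Lambda> * (2 * \<delta>))}"
    have "(\<Sum>x\<in>T. indicator (ball x (\<Lambda> * (2 * \<delta>))) y) = (\<Sum>x\<in>?S. 1 :: ennreal)"
      using T(1) by (intro sum.mono_neutral_cong_right) (auto split: split_indicator)
    also have "\<dots> = ennreal (real (card ?S))"
      by (simp add: ennreal_of_nat_eq_real_of_nat)
    also have "\<dots> \<le> ennreal (D ^ j)"
    proof (intro ennreal_leI doubling_separated_card_le[OF M D, where s = "2 * \<delta>"])
      show "?S \<subseteq> ball y (\<Lambda> * (2 * \<delta>))" by (auto simp: dist_commute)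
      show "4 * (\<Lambda> * (2 * \<delta>)) / (2 * \<delta>) + 1 \<le> 2 ^ j" using j \<delta> by simp
    qed (use T \<delta> pairwise_subset[OF sep] in auto)
    finally show ?thesis .
  qed
  have "emeasure M ?A \<le> emeasure M (\<Union>x\<in>T. ball x (2 * \<delta>))"
    using cover T by (intro emeasure_mono sets.finite_UN) auto
  also have "\<dots> \<le> (\<Sum>x\<in>T. emeasure M (ball x (2 * \<delta>)))"
    using T(1) by (intro emeasure_subadditive_finite) auto
  also have "\<dots> \<le> (\<Sum>x\<in>T. ennreal c * (\<integral>\<^sup>+y\<in>ball x (\<Lambda> * (2 * \<delta>)). epowr (h y) p \<partial>M))"
    using T(2) by (intro sum_mono local) auto
  also have "\<dots> = ennreal c * (\<integral>\<^sup>+y. epowr (h y) p * (\<Sum>x\<in>T. indicator (ball x (\<Lambda> * (2 * \<delta>))) y) \<partial>M)"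
    by (simp add: sum_distrib_left nn_integral_sum)
  also have "\<dots> \<le> ennreal c * (\<integral>\<^sup>+y. epowr (h y) p * ennreal (D ^ j) \<partial>M)"
    by (intro mult_left_mono nn_integral_mono overlap) auto
  also have "\<dots> = ennreal c * ennreal (D ^ j) * (\<integral>\<^sup>+y. epowr (h y) p \<partial>M)"
    by (simp add: nn_integral_multc mult.assoc mult.left_commute mult.commute)
  finally show ?thesis
    unfolding h_p c_def using D(1) by (simp add: ennreal_mult)
qed

theorem theorem4p4:
  fixes M :: "'a::metric_space measure" and x0 :: 'a and p a :: real
  assumes "metric_measure_space M"
    and "1 \<le> p"
    and "globally_doubling M"
    and "poincare_inequality M p"
    and "0 < a"
  shows "\<exists>C\<ge>1. \<forall>r R :: real.
    0 < R / 2 \<and> R / 2 \<le> r \<and> r < R \<and>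
    (\<forall>x \<in> ball x0 R - ball x0 r. \<exists>x' x''.
        ball x' (a * (R - r)) \<subseteq> ball x (2 * (R - r)) \<inter> ball x0 r \<and>
        ball x'' (a * (R - r)) \<subseteq> ball x (2 * (R - r)) - ball x0 R) \<longrightarrow>
    ennreal (1 / C) * (emeasure M (ball x0 R - ball x0 r) / ennreal ((R - r) powr p))
        \<le> var_cap M p (ball x0 r) (ball x0 R) \<and>
    var_cap M p (ball x0 r) (ball x0 R)
        \<le> ennreal C * (emeasure M (ball x0 R - ball x0 r) / ennreal ((R - r) powr p))"
proof -
  note M = assms(1)
  have p: "0 < p" using assms(2) by simp
  obtain D where D: "0 < D" "\<And>x r. 0 < r \<Longrightarrow> measure M (ball x (2 * r)) \<le> D * measure M (ball x r)"
    using globally_doubling_measure[OF M assms(3)] by blast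
  obtain C \<Lambda> where C: "0 < C" "1 \<le> \<Lambda>"
    and poincare: "\<forall>x r f g. 0 < r \<and> f \<in> borel_measurable M \<and> (\<integral>\<^sup>+y. e2ennreal \<bar>f y\<bar> \<partial>M) < \<infinity> \<and> upper_gradient f g \<longrightarrow>
        (\<integral>\<^sup>+y\<in>ball x r. e2ennreal \<bar>f y - ereal (ball_average M f x r)\<bar> \<partial>M) / emeasure M (ball x r)
          \<le> ennreal (C * r) * epowr ((\<integral>\<^sup>+y\<in>ball x (\<Lambda> * r). epowr (g y) p \<partial>M)
                      / emeasure M (ball x (\<Lambda> * r))) (1 / p)"
    using assms(4) unfolding poincare_inequality_def by (elim exE conjE)
  obtain k where k: "4 / a \<le> 2 ^ k"
    using real_arch_pow[of 2 "4 / a"] by (auto intro: less_imp_le)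
  obtain j where j: "4 * \<Lambda> + 1 \<le> 2 ^ j"
    using real_arch_pow[of 2 "4 * \<Lambda> + 1"] by (auto intro: less_imp_le)
  \<comment> \<open>The factor \<open>\<delta> powr p\<close> of \<open>measure_annulus_le\<close>
    is split off; it cancels against the denominator of the claim.\<close>
  define c where "c = (D ^ k * (C * 2)) powr p * D ^ j"
  have "0 < c" using D(1) C(1) by (simp add: c_def)
  \<comment> \<open>The upper bound holds with constant 1 and the lower one with \<open>c\<close>;
    the maximum serves both.\<close>
  show ?thesis
  proof (intro exI[of _ "max 1 c"] conjI allI impI)
    fix r R :: real
    assume *: "0 < R / 2 \<and> R / 2 \<le> r \<and> r < R \<and>
      (\<forall>x \<in> ball x0 R - ball x0 r. \<exists>x' x''.
        ball x' (a * (R - r)) \<subseteq> ball x (2 * (R - r)) \<inter> ball x0 r \<and>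
        ball x'' (a * (R - r)) \<subseteq> ball x (2 * (R - r)) - ball x0 R)"
    let ?A = "ball x0 R - ball x0 r"
    define \<delta> where "\<delta> = R - r"
    have "0 < \<delta>" "0 < R" "r < R" using * by (auto simp: \<delta>_def)
    have "var_cap M p (ball x0 r) (ball x0 R) \<le> 1 * (emeasure M ?A / ennreal (\<delta> powr p))"
      using var_cap_annulus_le[OF M p \<open>0 < R\<close> \<open>r < R\<close>] by (simp add: \<delta>_def)
    also have "\<dots> \<le> ennreal (max 1 c) * (emeasure M ?A / ennreal (\<delta> powr p))"
      by (intro mult_right_mono) (auto simp flip: ennreal_1 intro!: ennreal_leI)
    finally show "var_cap M p (ball x0 r) (ball x0 R)
        \<le> ennreal (max 1 c) * (emeasure M ?A / ennreal ((R - r) powr p))"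
      by (simp add: \<delta>_def)
    have "ennreal (1 / max 1 c) * (emeasure M ?A / ennreal (\<delta> powr p))
      \<le> (\<integral>\<^sup>+x\<in>ball x0 R. epowr (minimal_weak_ug M p u x) p \<partial>M)"
      if u: "u \<in> newtonian_space M p" "\<And>x. x \<in> ball x0 R \<Longrightarrow> indicator (ball x0 r) x \<le> u x \<and> u x \<le> 1"
        "\<And>x. x \<notin> ball x0 R \<Longrightarrow> u x = 0" for u
    proof (rule ennreal_le_epsilon)
      fix e :: real assume "0 < e"
      let ?I = "\<integral>\<^sup>+x\<in>ball x0 R. epowr (minimal_weak_ug M p u x) p \<partial>M"
      obtain g0 where "upper_gradient u g0" "(\<integral>\<^sup>+x. epowr (g0 x) p \<partial>M) < \<infinity>"
        using newtonian_space_upper_gradient[OF p u(1)] .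
      then have "is_minimal_weak_ug M p u (minimal_weak_ug M p u)"
        by (rule is_minimal_weak_ug_minimal_weak_ug[OF M p])
      \<comment> \<open>\<open>g\<close> is a genuine upper gradient, so the Poincare inequality
        applies to it; the error \<open>e\<close> is removed by
        \<open>ennreal_le_epsilon\<close>.\<close>
      then obtain g where g: "upper_gradient u g" "(\<integral>\<^sup>+x\<in>ball x0 R. epowr (g x) p \<partial>M) \<le> ?I + ennreal e"
        using weak_upper_gradient_approx[OF M p, of u "minimal_weak_ug M p u" "ball x0 R" e]
          metric_measure_space_measurable(2)[OF M, of "ball x0 R"] \<open>0 < e\<close>
        unfolding is_minimal_weak_ug_def by auto
      have meas: "u \<in> borel_measurable M"
        using u(1) by (simp add: newtonian_space_def)
      have "emeasure M ?A \<le> ennreal ((D ^ k * (C * (2 * \<delta>))) powr p * D ^ j) * (\<integral>\<^sup>+x\<in>ball x0 R. epowr (g x) p \<partial>M)"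
        by (rule measure_annulus_le[OF M p D C poincare[rule_format] assms(5) k j \<open>0 < \<delta>\<close> _ \<open>0 < R\<close> _ meas u(2,3) g(1)])
          (use * in \<open>auto simp: \<delta>_def\<close>)
      also have "\<dots> \<le> ennreal ((D ^ k * (C * (2 * \<delta>))) powr p * D ^ j) * (?I + ennreal e)"
        by (intro mult_left_mono g) simp
      also have "(D ^ k * (C * (2 * \<delta>))) powr p * D ^ j = c * \<delta> powr p"
        using D(1) C(1) \<open>0 < \<delta>\<close> by (simp add: c_def powr_mult algebra_simps)
      finally have le: "emeasure M ?A \<le> ennreal (c * \<delta> powr p) * (?I + ennreal e)" .
      \<comment> \<open>The cancellation in \<open>ennreal\<close> is confined to finite positive
        factors, so that none concerns the energy.\<close>
      have inv: "ennreal (1 / c) * (ennreal (c * \<delta> powr p) / ennreal (\<delta> powr p)) = 1"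
        using \<open>0 < c\<close> \<open>0 < \<delta>\<close> by (simp add: divide_ennreal ennreal_mult[symmetric])
      have "ennreal (1 / max 1 c) * (emeasure M ?A / ennreal (\<delta> powr p))
          \<le> ennreal (1 / c) * (emeasure M ?A / ennreal (\<delta> powr p))"
        using \<open>0 < c\<close> by (intro mult_right_mono ennreal_leI) (auto simp: frac_le)
      also have "\<dots> \<le> ennreal (1 / c) * (ennreal (c * \<delta> powr p) * (?I + ennreal e) / ennreal (\<delta> powr p))"
        by (intro mult_left_mono divide_right_mono_ennreal le) simp
      also have "\<dots> = (ennreal (1 / c) * (ennreal (c * \<delta> powr p) / ennreal (\<delta> powr p))) * (?I + ennreal e)"
        by (simp add: divide_ennreal_def mult_ac)
      also have "\<dots> = ?I + ennreal e"
        by (simp only: inv mult_1)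
      finally show "ennreal (1 / max 1 c) * (emeasure M ?A / ennreal (\<delta> powr p)) \<le> ?I + ennreal e" .
    qed
    then show "ennreal (1 / max 1 c) * (emeasure M ?A / ennreal ((R - r) powr p))
        \<le> var_cap M p (ball x0 r) (ball x0 R)"
      unfolding var_cap_def \<delta>_def by (intro INF_greatest) auto
  qed simp
qed

end
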